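(* Let $\mathcal H$ be a Hilbert space, let $e\in\mathcal B(\mathcal H)$ be an orthogonal projection and let $u\in\mathcal B(\mathcal H)$ be a hermitian involution. Denote by $\mathcal H_\pm=\{x\in\mathcal H: ux=\pm x\}$ the eigenspaces of $u$ corresponding to the eigenvalues $\pm1$. Let $\mathcal Q_u$ be the set of all orthogonal projections $q\in\mathcal B(\mathcal H)$ with $quq=0$, let $\mathcal W(e,u)$ be the $W^*$-algebra generated by $e$ and $u$, and let \[ d=\inf\{\|e-q\| : q\in\mathcal Q_u\cap\mathcal W(e,u)\} \] be the distance from $e$ to $\mathcal Q_u\cap\mathcal W(e,u)$. Then $d=1$ if the range of $e$ has a non-trivial intersection with $\mathcal H_+$ or with $\mathcal H_-$, and otherwise \[ d=\sqrt{\tfrac12\left(1-\sqrt{1-\|eue\|^2}\right)}. \]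
   Context: $\mathcal B(\mathcal H)$ is the $C^*$-algebra of all bounded linear operators on the (complex) Hilbert space $\mathcal H$, with the operator norm $\|\cdot\|$. A hermitian involution is an operator $u\in\mathcal B(\mathcal H)$ with $u=u^*$ and $u^2=I$. An orthogonal projection is an operator $q$ with $q=q^*=q^2$. $\mathcal W(e,u)$ is the smallest $W^*$-algebra (von Neumann algebra, i.e. weakly closed $*$-subalgebra of $\mathcal B(\mathcal H)$; it contains $I=u^2$) containing $e$ and $u$. "Non-trivial intersection" means an intersection different from $\{0\}$. *)

theory Defs
  imports "HOL-Analysis.Analysis"
begin

section \<open>Complex Hilbert spaces\<close>

class complex_vector = real_vector +
  fixes scaleC :: "complex \<Rightarrow> 'a \<Rightarrow> 'a" (infixr "*\<^sub>C" 75)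
  assumes scaleC_add_right: "c *\<^sub>C (x + y) = c *\<^sub>C x + c *\<^sub>C y"
    and scaleC_add_left: "(b + c) *\<^sub>C x = b *\<^sub>C x + c *\<^sub>C x"
    and scaleC_scaleC: "b *\<^sub>C c *\<^sub>C x = (b * c) *\<^sub>C x"
    and scaleC_one: "1 *\<^sub>C x = x"
    and scaleR_scaleC: "r *\<^sub>R x = complex_of_real r *\<^sub>C x"

text \<open>The inner product is linear in the second and conjugate linear in the first argument.
  The last axiom makes it positive definite and ties it to the norm, hence to the metric and the
  topology, of the underlying real normed space.\<close>

class complex_inner = complex_vector + real_normed_vector +
  fixes cinner :: "'a \<Rightarrow> 'a \<Rightarrow> complex"
  assumes cinner_commute: "cinner x y = cnj (cinner y x)"
    and cinner_add_right: "cinner x (y + z) = cinner x y + cinner x z"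
    and cinner_scaleC_right: "cinner x (c *\<^sub>C y) = c * cinner x y"
    and cinner_self: "cinner x x = complex_of_real ((norm x)\<^sup>2)"

class complex_hilbert = complex_inner + complete_space

instantiation complex :: complex_hilbert
begin

definition scaleC_complex :: "complex \<Rightarrow> complex \<Rightarrow> complex"
  where "scaleC_complex c x = c * x"

definition cinner_complex :: "complex \<Rightarrow> complex \<Rightarrow> complex"
  where "cinner_complex x y = cnj x * y"

instance
proof
  fix x :: complex
  show "cinner x x = complex_of_real ((norm x)\<^sup>2)"
    by (simp add: cinner_complex_def mult.commute complex_norm_square flip: of_real_power)
qed (simp_all add: scaleC_complex_def cinner_complex_def algebra_simps scaleR_conv_of_real)

end

lemma cinner_add_left: "cinner (x + y) z = cinner x z + cinner (y::'a::complex_inner) z"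
  by (metis cinner_add_right cinner_commute complex_cnj_add)

lemma cinner_scaleC_left: "cinner (c *\<^sub>C x) y = cnj c * cinner (x::'a::complex_inner) y"
  by (metis cinner_scaleC_right cinner_commute complex_cnj_mult)

lemma cinner_scaleR_right: "cinner x (r *\<^sub>R y) = of_real r * cinner (x::'a::complex_inner) y"
  by (simp add: scaleR_scaleC cinner_scaleC_right)

lemma cinner_scaleR_left: "cinner (r *\<^sub>R x) y = of_real r * cinner (x::'a::complex_inner) y"
  by (simp add: scaleR_scaleC cinner_scaleC_left)

lemma cinner_minus_right: "cinner x (- y) = - cinner (x::'a::complex_inner) y"
  using cinner_scaleR_right[of x "-1" y] by simp

lemma cinner_minus_left: "cinner (- x) y = - cinner (x::'a::complex_inner) y"
  using cinner_scaleR_left[of "-1" x y] by simp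

lemma cinner_diff_right: "cinner x (y - z) = cinner x y - cinner (x::'a::complex_inner) z"
  using cinner_add_right[of x y "- z"] by (simp add: cinner_minus_right)

lemma cinner_diff_left: "cinner (x - y) z = cinner x z - cinner (y::'a::complex_inner) z"
  using cinner_add_left[of x "- y" z] by (simp add: cinner_minus_left)

lemma cinner_zero_right: "cinner x 0 = 0"
  using cinner_minus_right[of x 0] by simp

lemma cinner_eq_zero_iff: "cinner x x = 0 \<longleftrightarrow> (x::'a::complex_inner) = 0"
  by (simp add: cinner_self)

lemma Re_cinner_commute: "Re (cinner x y) = Re (cinner (y::'a::complex_inner) x)"
  by (subst cinner_commute) simp

lemma norm_add_sqr:
  fixes x y :: "'a::complex_inner"
  shows "(norm (x + y))\<^sup>2 = (norm x)\<^sup>2 + 2 * Re (cinner x y) + (norm y)\<^sup>2"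
proof -
  have n: "(norm z)\<^sup>2 = Re (cinner z z)" for z :: 'a
    by (simp add: cinner_self flip: of_real_power)
  show ?thesis
    unfolding n by (simp add: cinner_add_left cinner_add_right Re_cinner_commute[of y x])
qed

lemma norm_diff_sqr:
  fixes x y :: "'a::complex_inner"
  shows "(norm (x - y))\<^sup>2 = (norm x)\<^sup>2 - 2 * Re (cinner x y) + (norm y)\<^sup>2"
  using norm_add_sqr[of x "- y"] by (simp add: cinner_minus_right)

lemma norm_scaleC:
  fixes x :: "'a::complex_inner"
  shows "norm (c *\<^sub>C x) = cmod c * norm x"
proof -
  have "complex_of_real ((norm (c *\<^sub>C x))\<^sup>2) = (c * cnj c) * complex_of_real ((norm x)\<^sup>2)"
    unfolding cinner_self[symmetric] by (simp add: cinner_scaleC_left cinner_scaleC_right)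
  also have "\<dots> = complex_of_real ((cmod c * norm x)\<^sup>2)"
    by (simp add: complex_norm_square[symmetric] power_mult_distrib)
  finally have "(norm (c *\<^sub>C x))\<^sup>2 = (cmod c * norm x)\<^sup>2"
    using of_real_eq_iff by blast
  then show ?thesis by (simp add: power2_eq_iff_nonneg)
qed

lemma quadratic_nonneg_imp_zero:
  fixes a b :: real
  assumes "\<And>t. 0 \<le> 2 * t * b + t\<^sup>2 * a"
  shows "b = 0"
proof (rule ccontr)
  assume b: "b \<noteq> 0"
  define s where "s = 1 / (\<bar>a\<bar> + 1)"
  have s: "s > 0" "s * \<bar>a\<bar> < 1" by (simp_all add: s_def field_simps)
  have "0 \<le> 2 * (- s * b) * b + (- s * b)\<^sup>2 * a" by (rule assms)
  also have "\<dots> = s * b\<^sup>2 * (s * a - 2)" by (simp add: power2_eq_square algebra_simps)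
  finally have "0 \<le> s * b\<^sup>2 * (s * a - 2)" .
  moreover have "s * a \<le> s * \<bar>a\<bar>" using s(1) by (intro mult_left_mono) auto
  then have "s * a - 2 < 0" using s(2) by linarith
  moreover have "s * b\<^sup>2 > 0" using s b by simp
  ultimately show False by (smt (verit) mult_pos_neg)
qed

lemma cinner_Cauchy_Schwarz:
  fixes x y :: "'a::complex_inner"
  shows "cmod (cinner x y) \<le> norm x * norm y"
proof (cases "x = 0")
  case True
  then show ?thesis by (metis cinner_commute cinner_zero_right complex_cnj_zero mult_zero_left norm_zero order_refl)
next
  case False
  define n where "n = complex_of_real ((norm x)\<^sup>2)"
  have n0: "n \<noteq> 0" "cnj n = n" using False by (simp_all add: n_def)
  define c where "c = cinner x y / n"
  have "cinner (y - c *\<^sub>C x) (y - c *\<^sub>C x)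
      = cinner y y - c * cinner y x - cnj c * cinner x y + cnj c * c * n"
    by (simp add: cinner_diff_left cinner_diff_right cinner_scaleC_left cinner_scaleC_right
        cinner_self[of x] n_def algebra_simps)
  also have "cinner y x = cnj (cinner x y)" by (rule cinner_commute)
  also have "cinner y y - c * cnj (cinner x y) - cnj c * cinner x y + cnj c * c * n
      = cinner y y - (cinner x y * cnj (cinner x y)) / n"
    using n0 by (simp add: c_def field_simps)
  finally have "complex_of_real ((norm (y - c *\<^sub>C x))\<^sup>2)
      = complex_of_real ((norm y)\<^sup>2 - (cmod (cinner x y))\<^sup>2 / (norm x)\<^sup>2)"
    unfolding cinner_self n_def by (simp add: complex_norm_square[symmetric])
  then have "(norm (y - c *\<^sub>C x))\<^sup>2 = (norm y)\<^sup>2 - (cmod (cinner x y))\<^sup>2 / (norm x)\<^sup>2"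
    using of_real_eq_iff by blast
  then have "(cmod (cinner x y))\<^sup>2 / (norm x)\<^sup>2 \<le> (norm y)\<^sup>2"
    by (smt (verit) zero_le_power2)
  then have "(cmod (cinner x y))\<^sup>2 \<le> (norm x * norm y)\<^sup>2"
    using False by (simp add: field_simps)
  then show ?thesis by (rule power2_le_imp_le) simp
qed

lemma parallelogram:
  fixes x y :: "'a::complex_inner"
  shows "(norm (x - y))\<^sup>2 = 2 * (norm x)\<^sup>2 + 2 * (norm y)\<^sup>2 - 4 * (norm ((1/2) *\<^sub>R (x + y)))\<^sup>2"
  by (simp add: norm_diff_sqr norm_add_sqr power_divide cinner_scaleR_left cinner_scaleR_right
      field_simps)

lemma riesz_representation:
  fixes f :: "'a::complex_hilbert \<Rightarrow> complex"
  assumes add: "\<And>x y. f (x + y) = f x + f y"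
    and scale: "\<And>c x. f (c *\<^sub>C x) = c * f x"
    and bd: "\<And>x. cmod (f x) \<le> C * norm x"
  shows "\<exists>z. \<forall>x. f x = cinner z x"
proof -
  define p where "p x = (norm x)\<^sup>2 - 2 * Re (f x)" for x
  have lower: "- C\<^sup>2 \<le> p x" for x
  proof -
    have "Re (f x) \<le> C * norm x" using bd[of x] complex_Re_le_cmod[of "f x"] by linarith
    moreover have "0 \<le> (norm x - C)\<^sup>2" by simp
    ultimately show ?thesis unfolding p_def power2_diff by (simp add: algebra_simps)
  qed
  define m where "m = Inf (range p)"
  have bdd: "bdd_below (range p)" using lower by (intro bdd_belowI[of _ "- C\<^sup>2"]) auto
  have m_le: "m \<le> p x" for x unfolding m_def by (intro cInf_lower bdd) auto
  have "\<exists>x. p x < m + 1 / real (Suc n)" for n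
  proof -
    have "Inf (range p) < m + 1 / real (Suc n)" by (simp add: m_def)
    then show ?thesis using cInf_less_iff[OF _ bdd] by auto
  qed
  then obtain X where X: "\<And>n. p (X n) < m + 1 / real (Suc n)" by metis
  have fR: "f (r *\<^sub>R x) = of_real r * f x" for r x by (simp add: scaleR_scaleC scale)
  have fdiff: "f (x - y) = f x - f y" for x y
    using add[of x "- y"] fR[of "-1" y] by simp
  have par: "(norm (a - b))\<^sup>2 = 2 * p a + 2 * p b - 4 * p ((1/2) *\<^sub>R (a + b))" for a b
    unfolding parallelogram[of a b] p_def fR add by (simp add: field_simps)
  have par_le: "(norm (a - b))\<^sup>2 \<le> 2 * p a + 2 * p b - 4 * m" for a b
    using par[of a b] m_le[of "(1/2) *\<^sub>R (a + b)"] by linarith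
  have "Cauchy X"
  proof (rule CauchyI)
    fix r :: real assume r: "r > 0"
    obtain N where N: "1 / real (Suc N) < r\<^sup>2 / 4"
      using nat_approx_posE[of "r\<^sup>2 / 4"] r by auto
    have "norm (X i - X j) < r" if "i \<ge> N" "j \<ge> N" for i j
    proof -
      have "1 / real (Suc i) \<le> 1 / real (Suc N)" "1 / real (Suc j) \<le> 1 / real (Suc N)"
        using that by (auto simp: frac_le)
      then have "(norm (X i - X j))\<^sup>2 < r\<^sup>2"
        using par_le[of "X i" "X j"] X[of i] X[of j] N by linarith
      then show ?thesis using r by (simp add: power2_less_imp_less)
    qed
    then show "\<exists>M. \<forall>i\<ge>M. \<forall>j\<ge>M. norm (X i - X j) < r" by blast
  qed
  then obtain z where z: "X \<longlonglongrightarrow> z" using Cauchy_convergent convergent_def by blast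
  have fz: "(\<lambda>n. f (X n)) \<longlonglongrightarrow> f z"
  proof -
    have "(\<lambda>n. f (X n) - f z) \<longlonglongrightarrow> 0"
    proof (rule Lim_null_comparison)
      show "\<forall>\<^sub>F n in sequentially. norm (f (X n) - f z) \<le> C * norm (X n - z)"
        by (intro always_eventually allI) (simp add: bd flip: fdiff)
      have "(\<lambda>n. C * norm (X n - z)) \<longlonglongrightarrow> C * norm (z - z)"
        by (intro tendsto_intros z)
      then show "(\<lambda>n. C * norm (X n - z)) \<longlonglongrightarrow> 0" by simp
    qed
    then show ?thesis by (simp add: LIM_zero_iff)
  qed
  have "(\<lambda>n. p (X n)) \<longlonglongrightarrow> p z"
    unfolding p_def by (intro tendsto_intros z fz)
  moreover have "(\<lambda>n. m + 1 / real (Suc n)) \<longlonglongrightarrow> m + 0"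
    using tendsto_add[OF tendsto_const[of m] LIMSEQ_inverse_real_of_nat]
    by (simp add: inverse_eq_divide)
  ultimately have "p z \<le> m + 0"
    by (rule LIMSEQ_le) (use X less_imp_le in blast)
  then have pz: "p z \<le> p x" for x using m_le[of x] by simp
  have re: "Re (f x) = Re (cinner z x)" for x
  proof -
    have "Re (cinner z x) - Re (f x) = 0"
    proof (rule quadratic_nonneg_imp_zero)
      fix t :: real
      show "0 \<le> 2 * t * (Re (cinner z x) - Re (f x)) + t\<^sup>2 * (norm x)\<^sup>2"
        using pz[of "z + t *\<^sub>R x"]
        by (simp add: p_def norm_add_sqr add fR cinner_scaleR_right power_mult_distrib algebra_simps)
    qed
    then show ?thesis by simp
  qed
  have "f x = cinner z x" for x
  proof (rule complex_eqI)
    show "Re (f x) = Re (cinner z x)" by (rule re)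
    show "Im (f x) = Im (cinner z x)"
      using re[of "\<i> *\<^sub>C x"] by (simp add: scale cinner_scaleC_right)
  qed
  then show ?thesis by blast
qed


section \<open>Bounded complex linear operators\<close>

text \<open>The type \<open>'a \<Rightarrow>\<^sub>L 'a\<close> consists of the bounded \<^emph>\<open>real\<close> linear operators, so
  the algebra of all bounded (complex linear) operators is cut out by \<open>bounded_ops\<close>. The norm of
  \<open>'a \<Rightarrow>\<^sub>L 'a\<close> restricts to the operator norm.\<close>

definition bounded_ops :: "('a::complex_hilbert \<Rightarrow>\<^sub>L 'a) set"
  where "bounded_ops = {T :: 'a \<Rightarrow>\<^sub>L 'a. \<forall>c x. T (c *\<^sub>C x) = c *\<^sub>C T x}"

lift_definition blinfun_scaleC ::
  "complex \<Rightarrow> ('a::complex_hilbert \<Rightarrow>\<^sub>L 'a) \<Rightarrow> ('a \<Rightarrow>\<^sub>L 'a)"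
  is "\<lambda>c T x. c *\<^sub>C T x"
proof -
  fix c and T :: "'a \<Rightarrow> 'a"
  assume "bounded_linear T"
  then interpret T: bounded_linear T .
  obtain K where K: "\<And>x. norm (T x) \<le> norm x * K" using T.bounded by blast
  show "bounded_linear (\<lambda>x. c *\<^sub>C T x)"
  proof (rule bounded_linear_intro[of _ "cmod c * K"])
    show "norm (c *\<^sub>C T x) \<le> norm x * (cmod c * K)" for x
      using mult_left_mono[OF K[of x] norm_ge_zero[of c]] by (simp add: norm_scaleC algebra_simps)
  qed (simp_all add: T.add T.scaleR scaleC_add_right, simp add: scaleR_scaleC scaleC_scaleC mult.commute)
qed

definition cadjoint :: "('a::complex_hilbert \<Rightarrow>\<^sub>L 'a) \<Rightarrow> ('a \<Rightarrow>\<^sub>L 'a)"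
  where "cadjoint T = (THE S. S \<in> bounded_ops \<and> (\<forall>x y. cinner (S x) y = cinner x (T y)))"

lemma cinner_left_eqI:
  fixes a b :: "'a::complex_hilbert"
  assumes "\<And>y. cinner a y = cinner b y"
  shows "a = b"
  using assms[of "a - b"] cinner_eq_zero_iff[of "a - b"] by (simp add: cinner_diff_left)

lemma cadjoint_ex1:
  fixes T :: "'a::complex_hilbert \<Rightarrow>\<^sub>L 'a"
  assumes T: "T \<in> bounded_ops"
  shows "\<exists>!S. S \<in> bounded_ops \<and> (\<forall>x y. cinner (S x) y = cinner x (T y))"
proof -
  have "\<exists>z. \<forall>y. cinner x (T y) = cinner z y" for x
  proof (rule riesz_representation[where C = "norm x * norm T"])
    show "cmod (cinner x (T y)) \<le> norm x * norm T * norm y" for y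
      using cinner_Cauchy_Schwarz[of x "T y"] mult_left_mono[OF norm_blinfun[of T y] norm_ge_zero[of x]]
      by (simp add: mult.assoc)
  qed (use T in \<open>auto simp: bounded_ops_def blinfun.add_right cinner_add_right cinner_scaleC_right\<close>)
  then obtain g where g: "\<And>x y. cinner x (T y) = cinner (g x) y" by metis
  have g_scale: "g (c *\<^sub>C x) = c *\<^sub>C g x" for c x
    by (rule cinner_left_eqI) (simp add: cinner_scaleC_left flip: g)
  have "bounded_linear g"
  proof (rule bounded_linear_intro[of _ "norm T"])
    show "g (x + y) = g x + g y" for x y
      by (rule cinner_left_eqI) (simp add: cinner_add_left flip: g)
    show "g (r *\<^sub>R x) = r *\<^sub>R g x" for r x
      by (simp add: scaleR_scaleC g_scale)
    show "norm (g x) \<le> norm x * norm T" for x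
    proof (cases "g x = 0")
      case False
      have "complex_of_real ((norm (g x))\<^sup>2) = cinner x (T (g x))"
        by (simp only: g cinner_self)
      then have "(norm (g x))\<^sup>2 = cmod (cinner x (T (g x)))"
        by (metis abs_of_nonneg norm_of_real zero_le_power2)
      also have "\<dots> \<le> norm x * norm (T (g x))" by (rule cinner_Cauchy_Schwarz)
      also have "\<dots> \<le> norm x * (norm T * norm (g x))"
        by (intro mult_left_mono norm_blinfun norm_ge_zero)
      finally have "norm (g x) * norm (g x) \<le> (norm x * norm T) * norm (g x)"
        by (simp add: power2_eq_square mult.assoc)
      then show ?thesis using False by (simp only: mult_le_cancel_right) simp
    qed simp
  qed
  then have S: "blinfun_apply (Blinfun g) = g" by (rule bounded_linear_Blinfun_apply)
  show ?thesis
  proof (rule ex1I[of _ "Blinfun g"])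
    show "Blinfun g \<in> bounded_ops \<and> (\<forall>x y. cinner (Blinfun g x) y = cinner x (T y))"
      by (simp add: S bounded_ops_def g_scale g)
    fix R assume R: "R \<in> bounded_ops \<and> (\<forall>x y. cinner (R x) y = cinner x (T y))"
    show "R = Blinfun g"
      by (rule blinfun_eqI, rule cinner_left_eqI) (use R in \<open>simp add: S g\<close>)
  qed
qed

lemma cadjoint_in: "T \<in> bounded_ops \<Longrightarrow> cadjoint T \<in> bounded_ops"
  and cadjoint_left: "T \<in> bounded_ops \<Longrightarrow> cinner (cadjoint T x) y = cinner x (T y)"
  unfolding cadjoint_def using theI'[OF cadjoint_ex1, of T] by blast+

definition orthogonal_projection :: "('a::complex_hilbert \<Rightarrow>\<^sub>L 'a) \<Rightarrow> bool"
  where "orthogonal_projection q \<longleftrightarrow> q \<in> bounded_ops \<and> q = cadjoint q \<and> q = q o\<^sub>L q"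

definition hermitian_involution :: "('a::complex_hilbert \<Rightarrow>\<^sub>L 'a) \<Rightarrow> bool"
  where "hermitian_involution u \<longleftrightarrow>
    u \<in> bounded_ops \<and> u = cadjoint u \<and> u o\<^sub>L u = id_blinfun"

definition eigenspace :: "('a::complex_hilbert \<Rightarrow>\<^sub>L 'a) \<Rightarrow> complex \<Rightarrow> 'a set"
  where "eigenspace T c = {x. T x = c *\<^sub>C x}"


section \<open>Von Neumann algebras of operators\<close>

text \<open>The coarsest topology on the bounded operators for which all the maps
  \<open>T \<mapsto> cinner x (T y)\<close> are continuous; \<open>euclidean\<close> is here the product topology on
  \<open>'a \<times> 'a \<Rightarrow> complex\<close>.\<close>

definition weak_operator_topology :: "('a::complex_hilbert \<Rightarrow>\<^sub>L 'a) topology"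
  where "weak_operator_topology =
    pullback_topology bounded_ops (\<lambda>T (x, y). cinner x (T y)) euclidean"

text \<open>The identity operator is not required to belong to the algebra.\<close>

definition wstar_algebra :: "('a::complex_hilbert \<Rightarrow>\<^sub>L 'a) set \<Rightarrow> bool"
  where "wstar_algebra A \<longleftrightarrow>
    A \<subseteq> bounded_ops \<and> 0 \<in> A \<and>
    (\<forall>S\<in>A. \<forall>T\<in>A. S + T \<in> A) \<and>
    (\<forall>c. \<forall>T\<in>A. blinfun_scaleC c T \<in> A) \<and>
    (\<forall>S\<in>A. \<forall>T\<in>A. S o\<^sub>L T \<in> A) \<and>
    (\<forall>T\<in>A. cadjoint T \<in> A) \<and>
    closedin weak_operator_topology A"

definition wstar_generated :: "('a::complex_hilbert \<Rightarrow>\<^sub>L 'a) set \<Rightarrow> ('a \<Rightarrow>\<^sub>L 'a) set"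
  where "wstar_generated M = \<Inter> {A. wstar_algebra A \<and> M \<subseteq> A}"

lemma topspace_weak_operator_topology: "topspace weak_operator_topology = bounded_ops"
  by (simp add: weak_operator_topology_def topspace_pullback_topology)

lemma wstar_algebra_bounded_ops: "wstar_algebra bounded_ops"
proof -
  have "closedin weak_operator_topology (bounded_ops :: ('a \<Rightarrow>\<^sub>L 'a) set)"
    using closedin_topspace[of weak_operator_topology] by (simp add: topspace_weak_operator_topology)
  moreover have "blinfun_scaleC c T \<in> bounded_ops"
    if "T \<in> bounded_ops" for c and T :: "'a \<Rightarrow>\<^sub>L 'a"
    using that by (simp add: bounded_ops_def blinfun_scaleC.rep_eq scaleC_scaleC mult.commute)
  moreover have "c *\<^sub>C 0 = (0::'a)" for c
    using scaleC_add_right[of c 0 "0::'a"] by simp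
  ultimately show ?thesis
    unfolding wstar_algebra_def
    by (auto simp: cadjoint_in) (auto simp: bounded_ops_def blinfun.add_left scaleC_add_right)
qed

lemma wstar_algebra_generated:
  assumes "M \<subseteq> bounded_ops"
  shows "wstar_algebra (wstar_generated M)"
proof -
  let ?F = "{A. wstar_algebra A \<and> M \<subseteq> A}"
  have F: "bounded_ops \<in> ?F" using assms wstar_algebra_bounded_ops by simp
  have "closedin weak_operator_topology (\<Inter> ?F)"
    using F by (intro closedin_Inter) (auto simp: wstar_algebra_def)
  moreover have "\<Inter> ?F \<subseteq> bounded_ops" using F by (rule Inter_lower)
  ultimately show ?thesis
    unfolding wstar_generated_def wstar_algebra_def[of "\<Inter> ?F"]
    by (intro conjI ballI allI InterI) (auto simp: wstar_algebra_def)
qed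

definition Q_set :: "('a::complex_hilbert \<Rightarrow>\<^sub>L 'a) \<Rightarrow> ('a \<Rightarrow>\<^sub>L 'a) set"
  where "Q_set u = {q. orthogonal_projection q \<and> q o\<^sub>L u o\<^sub>L q = 0}"

end

theory Submission
  imports Defs
begin

text \<open>
  Lower bounds. If \<open>x\<close> is a common eigenvector of \<open>e\<close> and \<open>u\<close> with \<open>e x = x\<close>, it is an eigenvector of
  every element of the generated algebra, and \<open>q u q = 0\<close> forces \<open>q x = 0\<close>. In general, for \<open>x\<close> in the
  range of \<open>e\<close> split \<open>x = q x + z\<close>; since \<open>q\<close> and \<open>u q u\<close> are orthogonal, \<open>\<bar>\<langle>x, u x\<rangle>\<bar>\<close> is at most
  \<open>2 \<parallel>q x\<parallel> \<parallel>z\<parallel>\<close> as soon as \<open>\<parallel>z\<parallel> \<le> \<parallel>q x\<parallel>\<close>, which bounds \<open>\<parallel>e u e\<parallel>\<close> in terms of \<open>\<parallel>e - q\<parallel>\<close>.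

  Attainment. Put \<open>D = e - u e u\<close>, so that \<open>u D u = - D\<close>. Then \<open>M = \<bar>D\<bar>\<close> commutes with \<open>e\<close> and \<open>u\<close>, and
  the support projection \<open>q\<close> of \<open>M + D\<close> (twice the positive part of \<open>D\<close>) satisfies \<open>q u q = 0\<close>. When the
  range of \<open>e\<close> meets both eigenspaces trivially, \<open>M\<close> is injective on it and \<open>2 e q e = e + e M e\<close>, where
  \<open>M\<^sup>2 e = e - (e u e)\<^sup>2\<close>; this gives the upper bound for \<open>\<parallel>e - q\<parallel>\<close>.
\<close>

text \<open>Makes the operators on a \<open>complex_hilbert\<close> type a Banach space, so that
  norm-Cauchy sequences of operators converge.\<close>

instance complex_hilbert \<subseteq> banach ..

section \<open>Inner products: elementary identities and continuity\<close>

lemma scaleC_zero_right: "c *\<^sub>C 0 = (0::'a::complex_vector)"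
  using scaleC_add_right[of c 0 "0::'a"] by simp

lemma cinner_zero_left: "cinner 0 (x::'a::complex_inner) = 0"
  using cinner_minus_left[of 0 x] by simp

lemma cinner_right_eqI:
  fixes a b :: "'a::complex_hilbert"
  assumes "\<And>x. cinner x a = cinner x b"
  shows "a = b"
  by (rule cinner_left_eqI) (metis assms cinner_commute)

lemma Re_cinner_self: "Re (cinner x x) = (norm (x::'a::complex_inner))\<^sup>2"
  by (simp add: cinner_self flip: of_real_power)

lemma Re_cinner_le: "Re (cinner x y) \<le> norm (x::'a::complex_inner) * norm y"
  using cinner_Cauchy_Schwarz[of x y] complex_Re_le_cmod[of "cinner x y"] by linarith

lemmas cinner_simps = cinner_add_left cinner_add_right cinner_diff_left cinner_diff_right
  cinner_minus_left cinner_minus_right cinner_scaleR_left cinner_scaleR_right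
  cinner_zero_left cinner_zero_right

lemma tendsto_cinner_right:
  fixes x :: "'a::complex_inner"
  assumes "(f \<longlongrightarrow> y) F"
  shows "((\<lambda>n. cinner x (f n)) \<longlongrightarrow> cinner x y) F"
proof -
  have "((\<lambda>n. cinner x (f n) - cinner x y) \<longlongrightarrow> 0) F"
  proof (rule Lim_null_comparison)
    show "\<forall>\<^sub>F n in F. norm (cinner x (f n) - cinner x y) \<le> norm x * norm (f n - y)"
      by (intro always_eventually allI) (simp add: cinner_Cauchy_Schwarz flip: cinner_diff_right)
    have "((\<lambda>n. norm x * norm (f n - y)) \<longlongrightarrow> norm x * norm (y - y)) F"
      by (intro tendsto_intros assms)
    then show "((\<lambda>n. norm x * norm (f n - y)) \<longlongrightarrow> 0) F" by simp
  qed
  then show ?thesis by (simp add: LIM_zero_iff)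
qed

section \<open>Hermitian operators\<close>

text \<open>Symmetry of the form replaces the definite description \<open>cadjoint\<close>;
  \<open>bounded_ops_eq_cadjoint_iff\<close> translates between the two.\<close>

definition hermitian :: "('a::complex_hilbert \<Rightarrow>\<^sub>L 'a) \<Rightarrow> bool"
  where "hermitian T \<longleftrightarrow> T \<in> bounded_ops \<and> (\<forall>x y. cinner (T x) y = cinner x (T y))"

lemma hermitian_bounded_ops: "hermitian T \<Longrightarrow> T \<in> bounded_ops"
  by (simp add: hermitian_def)

lemma hermitian_cinner: "hermitian T \<Longrightarrow> cinner (T x) y = cinner x (T y)"
  by (simp add: hermitian_def)

lemma bounded_ops_eq_cadjoint_iff:
  assumes "T \<in> bounded_ops"
  shows "T = cadjoint T \<longleftrightarrow> hermitian T"
proof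
  assume "T = cadjoint T"
  then show "hermitian T" using assms cadjoint_left[OF assms] by (simp add: hermitian_def)
next
  assume "hermitian T"
  then show "T = cadjoint T"
    using cadjoint_ex1[OF assms] cadjoint_in[OF assms] cadjoint_left[OF assms]
    unfolding hermitian_def by blast
qed

lemma orthogonal_projection_iff:
  "orthogonal_projection q \<longleftrightarrow> hermitian q \<and> (\<forall>x. q (q x) = q x)"
proof -
  have "(q = q o\<^sub>L q) \<longleftrightarrow> (\<forall>x. q (q x) = q x)"
    by (metis blinfun_apply_blinfun_compose blinfun_eqI)
  then show ?thesis
    unfolding orthogonal_projection_def using bounded_ops_eq_cadjoint_iff hermitian_bounded_ops by blast
qed

lemma hermitian_involution_iff:
  "hermitian_involution u \<longleftrightarrow> hermitian u \<and> (\<forall>x. u (u x) = x)"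
proof -
  have "(u o\<^sub>L u = id_blinfun) \<longleftrightarrow> (\<forall>x. u (u x) = x)"
    by (metis blinfun_apply_blinfun_compose blinfun_apply_id_blinfun blinfun_eqI)
  then show ?thesis
    unfolding hermitian_involution_def using bounded_ops_eq_cadjoint_iff hermitian_bounded_ops by blast
qed

lemma wstar_add: "wstar_algebra A \<Longrightarrow> S \<in> A \<Longrightarrow> T \<in> A \<Longrightarrow> S + T \<in> A"
  and wstar_compose: "wstar_algebra A \<Longrightarrow> S \<in> A \<Longrightarrow> T \<in> A \<Longrightarrow> S o\<^sub>L T \<in> A"
  and wstar_zero: "wstar_algebra A \<Longrightarrow> 0 \<in> A"
  by (simp_all add: wstar_algebra_def)

lemma wstar_scaleR:
  assumes "wstar_algebra A" "T \<in> A"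
  shows "r *\<^sub>R T \<in> A"
proof -
  have "r *\<^sub>R T = blinfun_scaleC (complex_of_real r) T"
    by (rule blinfun_eqI) (simp add: blinfun_scaleC.rep_eq scaleR_blinfun.rep_eq scaleR_scaleC)
  then show ?thesis using assms by (simp add: wstar_algebra_def)
qed

lemma wstar_diff:
  assumes "wstar_algebra A" "S \<in> A" "T \<in> A"
  shows "S - T \<in> A"
  using wstar_add[OF assms(1,2) wstar_scaleR[OF assms(1,3), of "-1"]] by simp

lemma id_bounded_ops: "id_blinfun \<in> bounded_ops"
  by (simp add: bounded_ops_def)

lemma hermitian_id: "hermitian id_blinfun"
  by (simp add: hermitian_def id_bounded_ops)

lemma hermitian_zero: "hermitian 0"
  by (simp add: hermitian_def wstar_zero[OF wstar_algebra_bounded_ops] cinner_simps)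

lemma hermitian_add: "hermitian S \<Longrightarrow> hermitian T \<Longrightarrow> hermitian (S + T)"
  by (simp add: hermitian_def wstar_add[OF wstar_algebra_bounded_ops] blinfun.add_left cinner_simps)

lemma hermitian_diff: "hermitian S \<Longrightarrow> hermitian T \<Longrightarrow> hermitian (S - T)"
  by (simp add: hermitian_def wstar_diff[OF wstar_algebra_bounded_ops] blinfun.diff_left cinner_simps)

lemma hermitian_scaleR: "hermitian T \<Longrightarrow> hermitian (r *\<^sub>R T)"
  by (simp add: hermitian_def wstar_scaleR[OF wstar_algebra_bounded_ops] blinfun.scaleR_left cinner_simps)

lemma hermitian_sandwich: "hermitian S \<Longrightarrow> hermitian T \<Longrightarrow> hermitian (S o\<^sub>L T o\<^sub>L S)"
  by (simp add: hermitian_def wstar_compose[OF wstar_algebra_bounded_ops])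

lemma hermitian_square: "hermitian T \<Longrightarrow> hermitian (T o\<^sub>L T)"
  by (simp add: hermitian_def wstar_compose[OF wstar_algebra_bounded_ops])

text \<open>For hermitian factors T S is the adjoint of S T.\<close>

lemma hermitian_compose_zero_commute:
  assumes "hermitian S" "hermitian T" "\<And>x. S (T x) = 0"
  shows "T (S x) = 0"
  by (rule cinner_left_eqI)
    (simp add: hermitian_cinner[OF assms(1)] hermitian_cinner[OF assms(2)] assms(3) cinner_simps)

lemma orthogonal_projection_norm_le:
  assumes "orthogonal_projection q"
  shows "norm (q x) \<le> norm x"
proof -
  have h: "hermitian q" and i: "q (q x) = q x" using assms by (simp_all add: orthogonal_projection_iff)
  have "(norm (q x))\<^sup>2 = Re (cinner x (q x))"
    by (simp add: h hermitian_cinner i flip: Re_cinner_self)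
  also have "\<dots> \<le> norm x * norm (q x)" by (rule Re_cinner_le)
  finally show ?thesis by (cases "q x = 0") (simp_all add: power2_eq_square)
qed

lemma orthogonal_projection_norm_sqr:
  assumes "orthogonal_projection q"
  shows "(norm x)\<^sup>2 = (norm (q x))\<^sup>2 + (norm (x - q x))\<^sup>2"
proof -
  have h: "hermitian q" and i: "q (q x) = q x" using assms by (simp_all add: orthogonal_projection_iff)
  have "cinner (q x) x = cinner (q x) (q x)" 
    using hermitian_cinner[OF h, of x "q x"] hermitian_cinner[OF h, of "q x" x] by (simp add: i)
  then show ?thesis
    by (simp add: norm_diff_sqr Re_cinner_self Re_cinner_commute[of x])
qed

text \<open>Polarization recovers \<open>Re (cinner y (T x))\<close> from the quadratic form at
  \<open>x + y\<close> and \<open>x - y\<close>, and the parallelogram law bounds those two values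
  together.\<close>

lemma norm_hermitian_le:
  assumes T: "hermitian T" and K: "\<And>x. \<bar>Re (cinner x (T x))\<bar> \<le> K * (norm x)\<^sup>2"
  shows "norm (T x) \<le> K * norm x"
proof (cases "T x = 0")
  case True
  have "0 \<le> K * (norm x)\<^sup>2" using K[of x] by linarith
  then have "0 \<le> K * norm x" by (cases "x = 0") (auto simp: zero_le_mult_iff)
  with True show ?thesis by simp
next
  case False
  \<comment> \<open>\<open>y\<close> points along \<open>T x\<close> and has the length of
    \<open>x\<close>, so that the parallelogram law yields 4 |x|^2.\<close>
  define r where "r = norm x / norm (T x)"
  define y where "y = r *\<^sub>R T x"
  have y: "norm y = norm x" using False by (simp add: y_def r_def)
  have "Re (cinner (x + y) (T (x + y))) - Re (cinner (x - y) (T (x - y))) = 4 * Re (cinner y (T x))"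
    using Re_cinner_commute[of y "T x"]
    by (simp add: blinfun.add_right blinfun.diff_right cinner_simps hermitian_cinner[OF T, of x y])
  then have "4 * Re (cinner y (T x)) \<le> K * (norm (x + y))\<^sup>2 + K * (norm (x - y))\<^sup>2"
    using K[of "x + y"] K[of "x - y"] by linarith
  also have "\<dots> = 4 * (K * (norm x)\<^sup>2)" by (simp add: norm_add_sqr norm_diff_sqr y algebra_simps)
  finally have "r * (norm (T x))\<^sup>2 \<le> K * (norm x)\<^sup>2" by (simp add: y_def cinner_simps Re_cinner_self)
  then have *: "norm x * norm (T x) \<le> norm x * (K * norm x)"
    using False by (simp add: r_def power2_eq_square algebra_simps)
  have "x \<noteq> 0" using False by auto
  with * show ?thesis by simp
qed

section \<open>Closed sets in the weak operator topology\<close>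

text \<open>Convergence of all matrix coefficients is convergence in the product topology from which
  the weak operator topology is pulled back, and closed sets contain limits of their
  sequences.\<close>

lemma wstar_weak_limit:
  assumes A: "wstar_algebra A" and T: "\<And>n. T n \<in> A" and S: "S \<in> bounded_ops"
    and lim: "\<And>x y. (\<lambda>n. cinner x (T n y)) \<longlonglongrightarrow> cinner x (S y)"
  shows "S \<in> A"
proof (rule ccontr)
  let ?f = "\<lambda>(T::'a \<Rightarrow>\<^sub>L 'a) (x, y). cinner x (T y)"
  assume "S \<notin> A"
  have "openin weak_operator_topology (bounded_ops - A)"
    using A by (simp add: wstar_algebra_def closedin_def topspace_weak_operator_topology)
  then obtain U where U: "open U" "bounded_ops - A = ?f -` U \<inter> bounded_ops"
    unfolding weak_operator_topology_def openin_pullback_topology by (metis open_openin)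
  have "limitin (product_topology (\<lambda>i. euclidean) UNIV) (\<lambda>n. ?f (T n)) (?f S) sequentially"
    unfolding limitin_componentwise by (auto simp: lim)
  then have "(\<lambda>n. ?f (T n)) \<longlonglongrightarrow> ?f S" by (simp add: euclidean_product_topology)
  moreover have "?f S \<in> U" using S \<open>S \<notin> A\<close> U(2) by blast
  ultimately have "\<forall>\<^sub>F n in sequentially. ?f (T n) \<in> U" using U(1) by (simp add: tendsto_def)
  then obtain n where "?f (T n) \<in> U" by (meson eventually_sequentially order_refl)
  moreover have "T n \<in> bounded_ops" using A T[of n] by (auto simp: wstar_algebra_def)
  ultimately show False using U(2) T[of n] by blast
qed

lemma wstar_strong_limit:
  fixes S :: "'a::complex_hilbert \<Rightarrow>\<^sub>L 'a"
  assumes "wstar_algebra A" "\<And>n. T n \<in> A" "S \<in> bounded_ops" "\<And>y. (\<lambda>n. T n y) \<longlonglongrightarrow> S y"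
  shows "S \<in> A"
  by (rule wstar_weak_limit[where T = T]) (intro assms tendsto_cinner_right)+

lemma hermitian_strong_limit:
  fixes S :: "'a::complex_hilbert \<Rightarrow>\<^sub>L 'a"
  assumes "\<And>n. hermitian (T n)" "\<And>y. (\<lambda>n. T n y) \<longlonglongrightarrow> S y"
  shows "hermitian S"
proof -
  have "(\<lambda>n. cinner (T n x) y) \<longlonglongrightarrow> cinner (S x) y" for x y
    using tendsto_cnj[OF tendsto_cinner_right[OF assms(2), of y x]] by (simp flip: cinner_commute)
  moreover have "(\<lambda>n. cinner (T n x) y) \<longlonglongrightarrow> cinner x (S y)" for x y
    using tendsto_cinner_right[OF assms(2), of x y] by (simp add: assms(1) hermitian_cinner)
  ultimately have c: "cinner (S x) y = cinner x (S y)" for x y using LIMSEQ_unique by blast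
  \<comment> \<open>Symmetry of the form forces complex linearity of the limit.\<close>
  have "S (c *\<^sub>C x) = c *\<^sub>C S x" for c x
    by (rule cinner_left_eqI) (simp add: c cinner_scaleC_left)
  with c show ?thesis by (simp add: hermitian_def bounded_ops_def)
qed

text \<open>Matrix coefficients are weakly continuous, so each equation cuts out a closed set. Both
  algebras below have this shape; \<open>c = d = 0\<close> expresses that a coefficient
  vanishes.\<close>

lemma closedin_weak_operator_topology_Collect:
  "closedin weak_operator_topology
    {T \<in> bounded_ops. \<forall>(a, b, c, d) \<in> I. cinner a (blinfun_apply T b) = cinner c (T d)}"
proof -
  have cont: "continuous_map weak_operator_topology euclidean (\<lambda>T. cinner a (blinfun_apply T b))"
    for a b :: 'a
  proof -
    have "continuous_map weak_operator_topology euclidean ((\<lambda>g. g (a, b)) \<circ> (\<lambda>(T::'a \<Rightarrow>\<^sub>L 'a) (x, y). cinner x (T y)))"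
      unfolding weak_operator_topology_def
      by (rule continuous_map_pullback) (simp add: continuous_on_product_coordinates)
    then show ?thesis by (simp add: o_def)
  qed
  have "closedin weak_operator_topology
    {T \<in> topspace weak_operator_topology. cinner a (blinfun_apply T b) - cinner c (T d) \<in> {0}}" for a b c d :: 'a
    by (rule closedin_continuous_map_preimage[of _ euclidean]) (auto intro: continuous_map_diff cont)
  then have single: "closedin weak_operator_topology
    {T \<in> bounded_ops. cinner a (blinfun_apply T b) = cinner c (T d)}" for a b c d :: 'a
    by (simp add: topspace_weak_operator_topology)
  let ?K = "(\<lambda>(a, b, c, d). {T \<in> bounded_ops. cinner a (blinfun_apply T b) = cinner c (T d)}) ` I"
  \<comment> \<open>Inserting \<open>bounded_ops\<close> keeps the family non-empty when
    \<open>I\<close> is empty.\<close>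
  have "closedin weak_operator_topology (\<Inter> (insert bounded_ops ?K))"
    using single closedin_topspace[of "weak_operator_topology :: ('a \<Rightarrow>\<^sub>L 'a) topology"]
    by (intro closedin_Inter) (auto simp: topspace_weak_operator_topology)
  moreover have "\<Inter> (insert bounded_ops ?K) =
      {T \<in> bounded_ops. \<forall>(a, b, c, d) \<in> I. cinner a (blinfun_apply T b) = cinner c (T d)}"
    by auto
  ultimately show ?thesis by simp
qed

text \<open>An operator that lies in every W*-algebra containing \<open>Y\<close> inherits through
  this algebra the commutation of \<open>Y\<close> with \<open>e\<close>.\<close>

lemma wstar_algebra_commutant:
  assumes e: "hermitian e"
  shows "wstar_algebra {T \<in> bounded_ops. \<forall>x. T (e x) = e (T x)}" (is "wstar_algebra ?A")
proof -
  have "?A = {T \<in> bounded_ops. \<forall>(a, b, c, d) \<in> range (\<lambda>(x, y). (x, e y, e x, y)). cinner a (T b) = cinner c (T d)}"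
    by (auto simp: hermitian_cinner[OF e] intro!: cinner_right_eqI[where a = "blinfun_apply _ _"])
  then have "closedin weak_operator_topology ?A"
    by (rule ssubst) (rule closedin_weak_operator_topology_Collect)
  moreover have "cadjoint T (e x) = e (cadjoint T x)" if "T \<in> ?A" for T x
    by (rule cinner_left_eqI) (use that in \<open>simp add: cadjoint_left hermitian_cinner[OF e]\<close>)
  moreover have "c *\<^sub>C e x = e (c *\<^sub>C x)" for c x
    using hermitian_bounded_ops[OF e] by (simp add: bounded_ops_def)
  ultimately show ?thesis
    using wstar_algebra_bounded_ops[where 'a='a]
    unfolding wstar_algebra_def
    by (auto simp: blinfun.add_left blinfun.add_right blinfun_scaleC.rep_eq)
qed

text \<open>The component of \<open>w\<close> orthogonal to \<open>x\<close> is also orthogonal to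
  \<open>w\<close>, hence to itself.\<close>

lemma unit_vector_scaleC_eqI:
  fixes x w :: "'a::complex_inner"
  assumes x: "norm x = 1" and w: "\<And>y. cinner y x = 0 \<Longrightarrow> cinner y w = 0"
  shows "w = cinner x w *\<^sub>C x"
proof -
  define z where "z = w - cinner x w *\<^sub>C x"
  have "cinner x z = 0"
    by (simp add: z_def cinner_simps cinner_scaleC_right cinner_self[of x] x)
  then have zx: "cinner z x = 0" by (metis cinner_commute complex_cnj_zero)
  have "cinner z z = cinner z w - cinner x w * cinner z x"
    by (subst (2) z_def) (simp add: cinner_simps cinner_scaleC_right)
  then have "z = 0" by (simp add: zx w cinner_eq_zero_iff)
  then show ?thesis by (simp add: z_def)
qed

text \<open>These operators leave both the line of \<open>x\<close> and its orthogonal complement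
  invariant. The first condition makes \<open>x\<close> an eigenvector without naming the
  eigenvalue; the second one makes the set stable under adjoints.\<close>

lemma wstar_algebra_eigenvector:
  assumes x: "norm x = 1"
  shows "wstar_algebra {T \<in> bounded_ops. \<forall>y. cinner y x = 0 \<longrightarrow> cinner y (T x) = 0 \<and> cinner x (T y) = 0}"
    (is "wstar_algebra ?A")
proof -
  have eig: "T x = cinner x (T x) *\<^sub>C x" if "T \<in> ?A" for T
    using that by (intro unit_vector_scaleC_eqI x) blast
  have "?A = {T \<in> bounded_ops. \<forall>(a, b, c, d) \<in> (\<lambda>y. (y, x, 0, 0)) ` {y. cinner y x = 0} \<union> (\<lambda>y. (x, y, 0, 0)) ` {y. cinner y x = 0}. cinner a (T b) = cinner c (T d)}"
    by (auto simp: ball_Un cinner_simps)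
  then have cl: "closedin weak_operator_topology ?A"
    by (rule ssubst) (rule closedin_weak_operator_topology_Collect)
  have adj: "cadjoint T \<in> ?A" if "T \<in> ?A" for T
  proof -
    have T: "T \<in> bounded_ops" using that by simp
    have "cinner y (cadjoint T x) = cnj (cinner x (T y))" "cinner x (cadjoint T y) = cnj (cinner y (T x))" for y
      by (metis T cadjoint_left cinner_commute)+
    then show ?thesis using that by (simp add: cadjoint_in)
  qed
  have comp: "S o\<^sub>L T \<in> ?A" if S: "S \<in> ?A" and T: "T \<in> ?A" for S T
  proof -
    have Sb: "S (c *\<^sub>C v) = c *\<^sub>C S v" for c v using S by (simp add: bounded_ops_def)
    have "cinner y (S (T x)) = 0" if "cinner y x = 0" for y
      using S that by (subst eig[OF T]) (simp add: Sb cinner_scaleC_right)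
    moreover have "cinner x (S (T y)) = 0" if "cinner y x = 0" for y
    proof -
      have "cinner x (T y) = 0" using T that by blast
      then have "cinner (T y) x = 0" by (metis cinner_commute complex_cnj_zero)
      then show ?thesis using S by blast
    qed
    ultimately show ?thesis
      using S T by (simp add: wstar_compose[OF wstar_algebra_bounded_ops])
  qed
  show ?thesis
    using wstar_algebra_bounded_ops[where 'a='a] cl adj comp
    unfolding wstar_algebra_def
    by (auto simp: blinfun.add_left blinfun_scaleC.rep_eq cinner_simps cinner_scaleC_right)
qed

section \<open>Square roots and support projections\<close>

text \<open>\<open>id - Z\<close> is the square root of \<open>id - Y\<close>; stating the equation for \<open>Z\<close> avoids the identity, so that
  \<open>Z\<close> lies in every \<open>W\<^sup>*\<close>-algebra containing \<open>Y\<close>, unital or not.\<close>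

lemma hermitian_sqrt:
  assumes Y: "hermitian Y" "norm Y \<le> 1"
  obtains Z where "hermitian Z" "norm Z \<le> 1" "2 *\<^sub>R Z = Y + (Z o\<^sub>L Z)"
    "\<And>A. wstar_algebra A \<Longrightarrow> Y \<in> A \<Longrightarrow> Z \<in> A"
proof -
  \<comment> \<open>the same iteration on real numbers, started with \<open>1\<close> instead of \<open>Y\<close>, majorizes the increments\<close>
  define X where "X = rec_nat 0 (\<lambda>_ V. (1/2) *\<^sub>R (Y + (V o\<^sub>L V)))"
  define z where "z = rec_nat (0::real) (\<lambda>_ v. (1/2) * (1 + v * v))"
  have X: "X 0 = 0" "\<And>n. X (Suc n) = (1/2) *\<^sub>R (Y + (X n o\<^sub>L X n))" by (simp_all add: X_def)
  have z: "z 0 = 0" "\<And>n. z (Suc n) = (1/2) * (1 + z n * z n)" by (simp_all add: z_def)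
  have z01: "0 \<le> z n \<and> z n \<le> 1" for n
  proof (induction n)
    case (Suc n)
    then have "z n * z n \<le> 1" by (simp add: mult_le_one)
    then show ?case by (simp add: z)
  qed (simp add: z)
  have Xz: "norm (X n) \<le> z n" for n
  proof (induction n)
    case (Suc n)
    have "norm (X n o\<^sub>L X n) \<le> z n * z n"
      using norm_blinfun_compose[of "X n" "X n"] mult_mono'[OF Suc Suc] by simp
    then show ?case using norm_triangle_ineq[of Y "X n o\<^sub>L X n"] Y(2) by (simp add: X z)
  qed (simp add: X z)
  have step: "norm (X (Suc n) - X n) \<le> z (Suc n) - z n" for n
  proof (induction n)
    case 0
    then show ?case using Xz[of "Suc 0"] by (simp add: X z)
  next
    case (Suc n)
    let ?D = "X (Suc n) - X n" and ?d = "z (Suc n) - z n"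
    \<comment> \<open>Difference of squares for operators: A^2 - B^2 = A (A - B) + (A - B)
      B.\<close>
    have "X (Suc (Suc n)) - X (Suc n) = (1/2) *\<^sub>R ((X (Suc n) o\<^sub>L ?D) + (?D o\<^sub>L X n))"
      by (simp add: X(2)[of "Suc n"] X(2)[of n] bounded_bilinear.diff_left[OF bounded_bilinear_blinfun_compose]
        bounded_bilinear.diff_right[OF bounded_bilinear_blinfun_compose]
        scaleR_right_diff_distrib scaleR_right_distrib del: X)
    moreover have "norm (X (Suc n) o\<^sub>L ?D) \<le> z (Suc n) * ?d"
      using norm_blinfun_compose[of "X (Suc n)" ?D] mult_mono'[OF Xz[of "Suc n"] Suc] by simp
    moreover have "norm (?D o\<^sub>L X n) \<le> ?d * z n"
      using norm_blinfun_compose[of ?D "X n"] mult_mono'[OF Suc Xz[of n]] by simp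
    ultimately have "norm (X (Suc (Suc n)) - X (Suc n)) \<le> (1/2) * (z (Suc n) * ?d + ?d * z n)"
      using norm_triangle_ineq[of "X (Suc n) o\<^sub>L ?D" "?D o\<^sub>L X n"] by simp
    also have "\<dots> = z (Suc (Suc n)) - z (Suc n)"
      by (simp only: z(2)[of "Suc n"]) (simp add: z(2)[of n] algebra_simps)
    finally show ?case .
  qed
  have steps: "norm (X (n + k) - X n) \<le> z (n + k) - z n" for n k
  proof (induction k)
    case (Suc k)
    then show ?case
      using step[of "n + k"] norm_triangle_ineq[of "X (Suc (n + k)) - X (n + k)" "X (n + k) - X n"] by simp
  qed simp
  \<comment> \<open>By \<open>step\<close> the increments of \<open>z\<close> dominate norms, so
    \<open>z\<close> increases; being bounded by 1 it converges, and \<open>steps\<close> passes its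
    Cauchy property on to \<open>X\<close>.\<close>
  have "z n \<le> z (Suc n)" for n using norm_ge_zero[of "X (Suc n) - X n"] step[of n] by linarith
  then have "incseq z" by (simp add: incseq_SucI)
  then have "convergent z" using z01 by (intro Bseq_mono_convergent BseqI'[of _ 1]) (auto simp: incseqD)
  then have "Cauchy z" by (rule convergent_Cauchy)
  have "Cauchy X"
  proof (rule CauchyI')
    fix r :: real assume "r > 0"
    then obtain N where N: "\<forall>m\<ge>N. \<forall>n\<ge>N. norm (z m - z n) < r" using CauchyD[OF \<open>Cauchy z\<close>] by blast
    have "dist (X m) (X n) < r" if "m \<ge> N" "n > m" for m n
    proof -
      have "norm (X (m + (n - m)) - X m) \<le> z (m + (n - m)) - z m" by (rule steps)
      then have "norm (X n - X m) \<le> z n - z m" using that by simp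
      also have "\<dots> < r" using N[rule_format, of n m] that by simp
      finally show ?thesis by (simp add: dist_norm norm_minus_commute)
    qed
    then show "\<exists>M. \<forall>m\<ge>M. \<forall>n>m. dist (X m) (X n) < r" by blast
  qed
  then obtain Z where Z: "X \<longlonglongrightarrow> Z" using Cauchy_convergent convergent_def by blast
  have pt: "(\<lambda>n. X n y) \<longlonglongrightarrow> Z y" for y by (intro blinfun.tendsto tendsto_const Z)
  have hX: "hermitian (X n)" for n
    by (induction n) (simp_all add: X hermitian_zero hermitian_scaleR hermitian_add hermitian_square Y(1))
  have hZ: "hermitian Z" by (rule hermitian_strong_limit[where T = X]) (intro hX pt)+
  have "norm Z \<le> 1"
    by (rule LIMSEQ_le_const2[OF tendsto_norm[OF Z]]) (meson Xz z01 order_trans)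
  moreover have "2 *\<^sub>R Z = Y + (Z o\<^sub>L Z)"
  proof (rule LIMSEQ_unique)
    show "(\<lambda>n. 2 *\<^sub>R X (Suc n)) \<longlonglongrightarrow> 2 *\<^sub>R Z"
      by (intro tendsto_intros LIMSEQ_Suc Z)
    have "(\<lambda>n. Y + (X n o\<^sub>L X n)) \<longlonglongrightarrow> Y + (Z o\<^sub>L Z)"
      by (intro tendsto_add tendsto_const bounded_bilinear.tendsto[OF bounded_bilinear_blinfun_compose] Z)
    then show "(\<lambda>n. 2 *\<^sub>R X (Suc n)) \<longlonglongrightarrow> Y + (Z o\<^sub>L Z)" by (simp add: X)
  qed
  moreover have "Z \<in> A" if A: "wstar_algebra A" "Y \<in> A" for A
  proof (rule wstar_strong_limit[where T = X])
    show "X n \<in> A" for n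
      by (induction n) (simp_all add: X wstar_zero wstar_scaleR wstar_add wstar_compose A)
  qed (use A(1) hermitian_bounded_ops[OF hZ] pt in auto)
  ultimately show ?thesis using that hZ by blast
qed

text \<open>For 0 \<le> B \<le> id the real parts of <x, B^n x> decrease in n, and squared distances
  between iterates are combinations of these numbers. Hence the powers converge strongly, to the
  projection onto the fixed vectors of \<open>B\<close>.\<close>

lemma contraction_power_limit:
  assumes B: "hermitian B" and pos: "\<And>x. 0 \<le> Re (cinner x (B x))"
    and le: "\<And>x. Re (cinner x (B x)) \<le> (norm x)\<^sup>2"
  obtains P where "orthogonal_projection P" "\<And>x. (\<lambda>n. (blinfun_apply B ^^ n) x) \<longlonglongrightarrow> P x"
    "\<And>x. B (P x) = P x"
proof -
  let ?b = "\<lambda>n x. (blinfun_apply B ^^ n) x"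
  have B_le: "norm (B x) \<le> norm x" for x
    using norm_hermitian_le[OF B, of 1 x] pos le by simp
  have b_le: "norm (?b n x) \<le> norm x" for n x
  proof (induction n)
    case (Suc n)
    then show ?case using B_le[of "?b n x"] by simp
  qed simp
  have lin: "bounded_linear (?b n)" for n
  proof (induction n)
    case (Suc n)
    then show ?case using bounded_linear_compose[OF blinfun.bounded_linear_right] by (simp add: o_def)
  qed (simp add: id_def)
  have herm: "cinner (?b n x) y = cinner x (?b n y)" for n x y
    by (induction n arbitrary: x) (simp_all add: hermitian_cinner[OF B] funpow_swap1)
  define a where "a x n = Re (cinner x (?b n x))" for x n
  have a_shift: "a x (n + (n + k)) = a (?b n x) k" for x n k
  proof -
    have "?b (n + k) x = ?b k (?b n x)" by (simp add: funpow_add add.commute[of n])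
    then show ?thesis by (simp add: a_def funpow_add herm)
  qed
  have pos1: "0 \<le> Re (cinner x (x - B x))" for x
    using le[of x] by (simp add: cinner_simps Re_cinner_self)
  have dec0: "a x 1 \<le> a x 0" for x using le[of x] by (simp add: a_def Re_cinner_self)
  have dec1: "a x 2 \<le> a x 1" for x
  proof -
    \<comment> \<open>B - B^2 = (id - B) B (id - B) + B (id - B) B, a sum of two positive
      operators.\<close>
    have "a x 1 - a x 2 = Re (cinner (x - B x) (B (x - B x))) + Re (cinner (B x) (B x - B (B x)))"
      by (simp add: a_def cinner_simps blinfun.diff_right hermitian_cinner[OF B] numeral_2_eq_2)
    then show ?thesis using pos[of "x - B x"] pos1[of "B x"] by linarith
  qed
  \<comment> \<open>Through \<open>a_shift\<close>, replacing \<open>x\<close> by its iterate of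
    order n div 2 leaves only the first two decrements.\<close>
  have dec: "a x (Suc n) \<le> a x n" for x n
  proof (cases "even n")
    case True
    then obtain k where n: "n = k + k" by (metis evenE mult_2)
    show ?thesis using dec0[of "?b k x"] a_shift[of x k 0] a_shift[of x k 1] by (simp add: n)
  next
    case False
    then obtain k where n: "n = k + k + 1" by (metis oddE mult_2)
    show ?thesis using dec1[of "?b k x"] a_shift[of x k 1] a_shift[of x k 2] by (simp add: n)
  qed
  have a_bd: "\<bar>a x n\<bar> \<le> (norm x)\<^sup>2" for x n
  proof -
    have "\<bar>a x n\<bar> \<le> cmod (cinner x (?b n x))" unfolding a_def by (rule abs_Re_le_cmod)
    also have "\<dots> \<le> norm x * norm (?b n x)" by (rule cinner_Cauchy_Schwarz)
    also have "\<dots> \<le> norm x * norm x" by (intro mult_left_mono b_le norm_ge_zero)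
    finally show ?thesis by (simp add: power2_eq_square)
  qed
  have conv: "convergent (\<lambda>n. ?b n x)" for x
  proof -
    have "decseq (a x)" using dec by (simp add: decseq_Suc_iff)
    then have "convergent (a x)"
      using a_bd by (intro Bseq_monoseq_convergent BseqI'[of _ "(norm x)\<^sup>2"]) (auto simp: decseq_imp_monoseq)
    then obtain l where l: "a x \<longlonglongrightarrow> l" by (auto simp: convergent_def)
    have "a x (m + n) = Re (cinner (?b m x) (?b n x))" for m n
      by (simp add: a_def herm funpow_add)
    then have diff: "(norm (?b m x - ?b n x))\<^sup>2 = a x (m + m) - 2 * a x (m + n) + a x (n + n)" for m n
      by (simp add: norm_diff_sqr Re_cinner_self)
    have "Cauchy (\<lambda>n. ?b n x)"
    proof (rule CauchyI)
      fix r :: real assume r: "r > 0"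
      obtain N where N: "\<forall>n\<ge>N. norm (a x n - l) < r\<^sup>2 / 4"
        using LIMSEQ_D[OF l, of "r\<^sup>2 / 4"] r by auto
      have "norm (?b m x - ?b n x) < r" if mn: "m \<ge> N" "n \<ge> N" for m n
      proof -
        have "\<bar>a x (m + m) - l\<bar> < r\<^sup>2 / 4" "\<bar>a x (m + n) - l\<bar> < r\<^sup>2 / 4" "\<bar>a x (n + n) - l\<bar> < r\<^sup>2 / 4"
          using N mn by auto
        then have "(norm (?b m x - ?b n x))\<^sup>2 < r\<^sup>2" unfolding diff by linarith
        then show ?thesis using r by (simp add: power2_less_imp_less)
      qed
      then show "\<exists>M. \<forall>m\<ge>M. \<forall>n\<ge>M. norm (?b m x - ?b n x) < r" by blast
    qed
    then show ?thesis by (rule Cauchy_convergent)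
  qed
  define p where "p x = lim (\<lambda>n. ?b n x)" for x
  have p: "(\<lambda>n. ?b n x) \<longlonglongrightarrow> p x" for x
    using conv[of x] by (simp add: p_def convergent_LIMSEQ_iff)
  have "bounded_linear p"
  proof (rule bounded_linear_intro[of _ 1])
    fix x y :: 'a and r :: real
    show "p (x + y) = p x + p y"
      using tendsto_add[OF p[of x] p[of y]] p[of "x + y"] bounded_linear.linear[OF lin, THEN linear_add]
      by (simp add: LIMSEQ_unique)
    show "p (r *\<^sub>R x) = r *\<^sub>R p x"
      using tendsto_scaleR[OF tendsto_const[of r] p[of x]] p[of "r *\<^sub>R x"] bounded_linear.linear[OF lin, THEN linear_cmul]
      by (simp add: LIMSEQ_unique)
    show "norm (p x) \<le> norm x * 1"
      using LIMSEQ_le_const2[OF tendsto_norm[OF p[of x]], of "norm x"] b_le by auto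
  qed
  then have P: "blinfun_apply (Blinfun p) = p" by (rule bounded_linear_Blinfun_apply)
  have "hermitian (Blinfun p)"
  proof (rule hermitian_strong_limit[where T = "\<lambda>n. Blinfun (?b n)"])
    have *: "blinfun_apply (Blinfun (?b n)) = ?b n" for n by (rule bounded_linear_Blinfun_apply[OF lin])
    have "?b n (c *\<^sub>C x) = c *\<^sub>C ?b n x" for n c x
      by (rule cinner_left_eqI) (simp add: herm cinner_scaleC_left)
    then show "hermitian (Blinfun (?b n))" for n
      by (simp add: hermitian_def bounded_ops_def * herm)
    show "(\<lambda>n. Blinfun (?b n) y) \<longlonglongrightarrow> Blinfun p y" for y by (simp add: * P p)
  qed
  moreover have Bp: "B (p x) = p x" for x
  proof (rule LIMSEQ_unique)
    show "(\<lambda>n. ?b (Suc n) x) \<longlonglongrightarrow> B (p x)"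
      using bounded_linear.tendsto[OF blinfun.bounded_linear_right p[of x]] by simp
    show "(\<lambda>n. ?b (Suc n) x) \<longlonglongrightarrow> p x" by (rule LIMSEQ_Suc[OF p])
  qed
  moreover have "p (p x) = p x" for x
  proof -
    have "?b n (p x) = p x" for n by (induction n) (simp_all add: Bp)
    then show ?thesis using p[of "p x"] by (simp add: LIMSEQ_unique)
  qed
  ultimately show ?thesis
    using that[of "Blinfun p"] p by (simp add: P orthogonal_projection_iff)
qed

text \<open>The complement of the kernel projection is the strong limit of id - B^n. This places
  \<open>q\<close> in the algebra, and since each id - B^n takes its values in the range of
  \<open>R\<close>, it also yields the approximating \<open>w\<close>.\<close>

lemma hermitian_support_projection:
  assumes R: "hermitian R"
  obtains q where "orthogonal_projection q"
    "\<And>A. wstar_algebra A \<Longrightarrow> id_blinfun \<in> A \<Longrightarrow> R \<in> A \<Longrightarrow> q \<in> A"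
    "\<And>x. q (R x) = R x" "\<And>x. R x = 0 \<Longrightarrow> q x = 0" "\<And>x. \<exists>w. (\<lambda>n. R (w n)) \<longlonglongrightarrow> q x"
proof -
  \<comment> \<open>the powers of \<open>id - t R\<^sup>2\<close> converge strongly to the projection onto the kernel of \<open>R\<close>\<close>
  define t where "t = 1 / (1 + (norm R)\<^sup>2)"
  have "0 < 1 + (norm R)\<^sup>2" by (simp add: add_pos_nonneg)
  then have t: "t > 0" "t * (norm R)\<^sup>2 \<le> 1" by (simp_all add: t_def field_simps)
  define B where "B = id_blinfun - t *\<^sub>R (R o\<^sub>L R)"
  have B: "B x = x - t *\<^sub>R R (R x)" for x
    by (simp add: B_def blinfun.diff_left blinfun.scaleR_left)
  have hB: "hermitian B" unfolding B_def by (intro hermitian_diff hermitian_id hermitian_scaleR hermitian_square R)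
  have BB: "Re (cinner x (B x)) = (norm x)\<^sup>2 - t * (norm (R x))\<^sup>2" for x
    by (simp add: B cinner_simps Re_cinner_self flip: hermitian_cinner[OF R, of x "R x"])
  have Rx: "t * (norm (R x))\<^sup>2 \<le> (norm x)\<^sup>2" for x
  proof -
    have "(norm (R x))\<^sup>2 \<le> (norm R * norm x)\<^sup>2" by (intro power_mono norm_blinfun norm_ge_zero)
    then have "t * (norm (R x))\<^sup>2 \<le> (t * (norm R)\<^sup>2) * (norm x)\<^sup>2"
      using t(1) by (simp add: power_mult_distrib)
    also have "\<dots> \<le> 1 * (norm x)\<^sup>2" using t(2) by (intro mult_right_mono) auto
    finally show ?thesis by simp
  qed
  let ?b = "\<lambda>n x. (blinfun_apply B ^^ n) x"
  obtain P where P: "orthogonal_projection P" "\<And>x. (\<lambda>n. ?b n x) \<longlonglongrightarrow> P x" "\<And>x. B (P x) = P x"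
    by (rule contraction_power_limit[OF hB]) (use Rx BB t(1) in auto)
  have hP: "hermitian P" "\<And>x. P (P x) = P x" using P(1) by (simp_all add: orthogonal_projection_iff)
  define q where "q = id_blinfun - P"
  have q: "q x = x - P x" for x by (simp add: q_def blinfun.diff_left)
  have "hermitian q" unfolding q_def by (intro hermitian_diff hermitian_id hP)
  then have qq: "orthogonal_projection q"
    by (simp add: orthogonal_projection_iff q blinfun.diff_right hP)
  \<comment> \<open>\<open>P x\<close> is fixed by \<open>B\<close>, so \<open>BB\<close> leaves t
    |R (P x)|^2 = 0.\<close>
  have RP: "R (P x) = 0" for x
    using BB[of "P x"] t(1) by (simp add: P(3) Re_cinner_self)
  have "P (R x) = 0" for x by (rule hermitian_compose_zero_commute[OF R hP(1) RP])
  then have "q (R x) = R x" for x by (simp add: q)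
  moreover have "q x = 0" if "R x = 0" for x
  proof -
    have "?b n x = x" for n by (induction n) (simp_all add: B that)
    then show ?thesis using P(2)[of x] by (simp add: q LIMSEQ_const_iff)
  qed
  moreover have "\<exists>w. (\<lambda>n. R (w n)) \<longlonglongrightarrow> q x" for x
  proof -
    \<comment> \<open>Consecutive iterates differ by R (t R B^n x), so the preimages add up.\<close>
    have "\<exists>w. R w = x - ?b n x" for n
    proof (induction n)
      case 0
      show ?case by (rule exI[of _ 0]) simp
    next
      case (Suc n)
      then obtain w where "R w = x - ?b n x" by blast
      then have "R (w + t *\<^sub>R R (?b n x)) = x - ?b (Suc n) x"
        by (simp add: blinfun.add_right blinfun.scaleR_right B)
      then show ?case by blast
    qed
    then obtain w where "\<And>n. R (w n) = x - ?b n x" by metis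
    then have "(\<lambda>n. R (w n)) \<longlonglongrightarrow> q x" by (simp add: q) (intro tendsto_intros P(2))
    then show ?thesis by blast
  qed
  moreover have "q \<in> A" if A: "wstar_algebra A" "id_blinfun \<in> A" "R \<in> A" for A
  proof -
    have BA: "B \<in> A" unfolding B_def by (intro wstar_diff wstar_scaleR wstar_compose A)
    define C where "C = rec_nat id_blinfun (\<lambda>_ V. B o\<^sub>L V)"
    have C: "blinfun_apply (C n) = ?b n" for n by (induction n) (auto simp: C_def)
    have "P \<in> A"
    proof (rule wstar_strong_limit[where T = C])
      show "C n \<in> A" for n by (induction n) (simp_all add: C_def A BA wstar_compose)
    qed (use A(1) hermitian_bounded_ops[OF hP(1)] P(2) in \<open>auto simp: C\<close>)
    then show ?thesis unfolding q_def by (intro wstar_diff A)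
  qed
  ultimately show ?thesis using that[OF qq] by blast
qed

section \<open>Lower bounds for the distance\<close>

lemma orthogonal_projection_cinner_self:
  assumes "orthogonal_projection q"
  shows "Re (cinner x (q x)) = (norm (q x))\<^sup>2"
  using assms by (metis Re_cinner_self hermitian_cinner orthogonal_projection_iff)

lemma hermitian_involution_norm:
  assumes "hermitian_involution u"
  shows "norm (u x) = norm x"
proof -
  have "(norm (u x))\<^sup>2 = (norm x)\<^sup>2"
    using assms by (simp add: hermitian_involution_iff hermitian_cinner flip: Re_cinner_self)
  then show ?thesis by (simp add: power2_eq_iff_nonneg)
qed

lemma norm_compression_le_1:
  assumes "orthogonal_projection e" "hermitian_involution u"
  shows "norm (e o\<^sub>L u o\<^sub>L e) \<le> 1"
proof (rule norm_blinfun_bound)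
  fix x
  have "norm (e (u (e x))) \<le> norm (u (e x))" by (rule orthogonal_projection_norm_le[OF assms(1)])
  also have "\<dots> = norm (e x)" by (rule hermitian_involution_norm[OF assms(2)])
  also have "\<dots> \<le> norm x" by (rule orthogonal_projection_norm_le[OF assms(1)])
  finally show "norm ((e o\<^sub>L u o\<^sub>L e) x) \<le> 1 * norm x" by simp
qed simp

lemma Q_set_iff:
  "q \<in> Q_set u \<longleftrightarrow> orthogonal_projection q \<and> (\<forall>x. q (u (q x)) = 0)"
proof -
  have "(q o\<^sub>L u o\<^sub>L q = 0) \<longleftrightarrow> (\<forall>x. q (u (q x)) = 0)"
    by (metis blinfun_apply_blinfun_compose blinfun.zero_left blinfun_eqI)
  then show ?thesis by (simp add: Q_set_def)
qed

text \<open>Split x = y + p + w along the orthogonal projections q and u q u and the remainder. Only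
  the terms <y, u p>, <p, u y> and <w, u w> of the form survive, which bounds it by 2 |y| |p| +
  |w|^2.\<close>

lemma Q_set_cinner_involution_le:
  assumes u: "hermitian_involution u" and q: "q \<in> Q_set u" and le: "norm (x - q x) \<le> norm (q x)"
  shows "\<bar>Re (cinner x (u x))\<bar> \<le> 2 * norm (q x) * norm (x - q x)"
proof -
  have hu: "hermitian u" "\<And>x. u (u x) = x" using u by (simp_all add: hermitian_involution_iff)
  have hq: "hermitian q" "\<And>x. q (q x) = q x" "\<And>x. q (u (q x)) = 0"
    using q by (simp_all add: Q_set_iff orthogonal_projection_iff)
  define y where "y = q x"
  define z where "z = x - y"
  \<comment> \<open>\<open>p\<close> is the part of \<open>z\<close> in the range of u q u, which is
    orthogonal to the range of \<open>q\<close>.\<close>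
  define p where "p = u (q (u z))"
  define w where "w = z - p"
  have x: "x = y + z" and z: "z = p + w" by (simp_all add: z_def w_def)
  have qy: "q y = y" by (simp add: y_def hq)
  have qz: "q z = 0" by (simp add: z_def y_def blinfun.diff_right hq)
  have qw: "q w = 0" by (simp add: w_def p_def qz blinfun.diff_right hq)
  have up: "u p = q (u p)" by (simp add: p_def hu hq)
  have quw: "q (u w) = 0" by (simp add: w_def p_def blinfun.diff_right hu hq)
  have iso: "cinner (q a) (u (q b)) = 0" for a b
    by (simp add: hermitian_cinner[OF hq(1)] hq cinner_simps)
  have yy: "cinner y (u y) = 0" using iso[of y y] by (simp add: qy)
  have pp: "cinner p (u p) = 0"
    using iso[of "u p" "u p"] by (simp add: hu hermitian_cinner[OF hu(1)] flip: up)
  have pw: "cinner p (u w) = 0" "cinner w (u p) = 0"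
  proof -
    have "cinner w (u p) = cinner (q w) (u p)" by (subst up) (simp add: hermitian_cinner[OF hq(1)])
    then show "cinner w (u p) = 0" by (simp add: qw cinner_simps)
    then show "cinner p (u w) = 0" by (metis hermitian_cinner[OF hu(1)] cinner_commute complex_cnj_zero)
  qed
  have yw: "cinner y (u w) = 0"
    using hermitian_cinner[OF hq(1), of y "u w"] by (simp add: qy quw cinner_simps)
  have zz: "cinner z (u z) = cinner w (u w)"
    using pp pw by (simp add: z blinfun.add_right cinner_simps)
  have yz: "cinner y (u z) = cinner y (u p)" using yw by (simp add: z blinfun.add_right cinner_simps)
  note nu = hermitian_involution_norm[OF u]
  have nz: "(norm z)\<^sup>2 = (norm p)\<^sup>2 + (norm w)\<^sup>2"
  proof -
    have "cinner p w = cinner (u p) (u w)" by (simp add: hermitian_cinner[OF hu(1)] hu)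
    also have "\<dots> = cinner (u p) (q (u w))" by (subst up) (simp add: hermitian_cinner[OF hq(1)])
    finally show ?thesis by (subst z) (simp add: norm_add_sqr quw cinner_simps)
  qed
  have "cinner x (u x) = cinner y (u z) + cinner z (u y) + cinner z (u z)"
    using yy by (simp add: x blinfun.add_right cinner_simps)
  moreover have "Re (cinner z (u y)) = Re (cinner y (u z))"
    by (metis Re_cinner_commute hermitian_cinner[OF hu(1)])
  ultimately have "Re (cinner x (u x)) = 2 * Re (cinner y (u p)) + Re (cinner w (u w))"
    by (simp add: yz zz)
  moreover have "\<bar>Re (cinner y (u p))\<bar> \<le> norm y * norm p"
    using abs_Re_le_cmod[of "cinner y (u p)"] cinner_Cauchy_Schwarz[of y "u p"] by (simp add: nu)
  moreover have "\<bar>Re (cinner w (u w))\<bar> \<le> (norm w)\<^sup>2"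
    using abs_Re_le_cmod[of "cinner w (u w)"] cinner_Cauchy_Schwarz[of w "u w"] by (simp add: nu power2_eq_square)
  ultimately have "\<bar>Re (cinner x (u x))\<bar> \<le> 2 * (norm y * norm p) + (norm w)\<^sup>2" by linarith
  also have "\<dots> \<le> 2 * (norm y * norm z)"
  proof -
    \<comment> \<open>|w|^2 = (|z| - |p|) (|z| + |p|) \<le> 2 |y| (|z| - |p|), because |p| \<le> |z|
      \<le> |y|.\<close>
    have pz: "norm p \<le> norm z" by (rule power2_le_imp_le) (simp_all add: nz)
    have "norm z + norm p \<le> 2 * norm y" using pz le by (simp add: y_def z_def)
    then have "(norm z - norm p) * (norm z + norm p) \<le> (norm z - norm p) * (2 * norm y)"
      using pz by (intro mult_left_mono) auto
    then show ?thesis using nz by (simp add: power2_eq_square algebra_simps)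
  qed
  finally show ?thesis by (simp add: y_def z_def)
qed

text \<open>If \<delta>^2 > 1/2, the left side is at most sqrt (1/2) and nothing is left to show.
  Otherwise put \<delta> = sin t: then \<open>K\<close> is sin (2 t),
  \<open>1 - 2 * \<delta>\<^sup>2\<close> is cos (2 t), and the claim reduces to s \<le> K.\<close>

lemma Q_set_norm_diff_ge:
  assumes e: "orthogonal_projection e" and u: "hermitian_involution u" and q: "q \<in> Q_set u"
  shows "sqrt (1 / 2 * (1 - sqrt (1 - (norm (e o\<^sub>L u o\<^sub>L e))\<^sup>2))) \<le> norm (e - q)"
proof -
  define s where "s = norm (e o\<^sub>L u o\<^sub>L e)"
  define \<delta> where "\<delta> = norm (e - q)"
  have he: "hermitian e" "\<And>x. e (e x) = e x" using e by (simp_all add: orthogonal_projection_iff)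
  have hu: "hermitian u" using u by (simp add: hermitian_involution_iff)
  have hq: "orthogonal_projection q" using q by (simp add: Q_set_iff)
  have \<delta>0: "0 \<le> \<delta>" by (simp add: \<delta>_def)
  have "1 - 2 * \<delta>\<^sup>2 \<le> sqrt (1 - s\<^sup>2)" if \<delta>2: "\<delta>\<^sup>2 \<le> 1 / 2"
  proof -
    define K where "K = 2 * \<delta> * sqrt (1 - \<delta>\<^sup>2)"
    have K0: "0 \<le> K" using \<delta>0 \<delta>2 by (simp add: K_def)
    have K2: "K\<^sup>2 = 4 * (\<delta>\<^sup>2 * (1 - \<delta>\<^sup>2))" using \<delta>2 by (simp add: K_def power_mult_distrib)
    have *: "\<bar>Re (cinner x (u x))\<bar> \<le> K * (norm x)\<^sup>2" if ex: "e x = x" for x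
    proof -
      define a b n where "a = (norm (q x))\<^sup>2" and "b = (norm (x - q x))\<^sup>2" and "n = (norm x)\<^sup>2"
      have nab: "n = a + b" unfolding a_def b_def n_def by (rule orthogonal_projection_norm_sqr[OF hq])
      have "norm (x - q x) \<le> \<delta> * norm x"
        using norm_blinfun[of "e - q" x] by (simp add: \<delta>_def blinfun.diff_left ex)
      then have "b \<le> (\<delta> * norm x)\<^sup>2" unfolding b_def by (intro power_mono) auto
      then have b: "b \<le> \<delta>\<^sup>2 * n" by (simp add: power_mult_distrib n_def)
      have n0: "0 \<le> n" by (simp add: n_def)
      have \<delta>n: "\<delta>\<^sup>2 * n \<le> n / 2" using mult_right_mono[OF \<delta>2 n0] by simp
      have "b \<le> a" using b \<delta>n nab by linarith
      then have "norm (x - q x) \<le> norm (q x)" unfolding a_def b_def by (rule power2_le_imp_le) simp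
      from Q_set_cinner_involution_le[OF u q this]
      have "(\<bar>Re (cinner x (u x))\<bar>)\<^sup>2 \<le> (2 * norm (q x) * norm (x - q x))\<^sup>2"
        by (intro power_mono) auto
      also have "\<dots> = 4 * (b * (n - b))"
        by (simp add: nab) (simp add: a_def b_def power_mult_distrib)
      also have "\<dots> \<le> 4 * ((\<delta>\<^sup>2 * n) * (n - \<delta>\<^sup>2 * n))"
      proof -
        \<comment> \<open>The function v (n - v) increases up to v = n/2, and b \<le> \<delta>^2 n
          \<le> n/2.\<close>
        have "0 \<le> (\<delta>\<^sup>2 * n - b) * (n - (\<delta>\<^sup>2 * n) - b)"
          using b \<delta>n by (intro mult_nonneg_nonneg) auto
        then show ?thesis by (simp add: algebra_simps)
      qed
      also have "\<dots> = (K * n)\<^sup>2" by (simp add: power_mult_distrib K2) (simp add: power2_eq_square algebra_simps)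
      finally show ?thesis unfolding n_def
        by (rule power2_le_imp_le) (simp add: K0)
    qed
    have "norm ((e o\<^sub>L u o\<^sub>L e) x) \<le> K * norm x" for x
    proof (rule norm_hermitian_le)
      show "hermitian (e o\<^sub>L u o\<^sub>L e)" by (intro hermitian_sandwich he hu)
      fix x
      have "cinner x ((e o\<^sub>L u o\<^sub>L e) x) = cinner (e x) (u (e x))" by (simp add: hermitian_cinner[OF he(1)])
      moreover have "\<bar>Re (cinner (e x) (u (e x)))\<bar> \<le> K * (norm (e x))\<^sup>2" by (rule *) (rule he)
      moreover have "K * (norm (e x))\<^sup>2 \<le> K * (norm x)\<^sup>2"
        by (intro mult_left_mono power_mono orthogonal_projection_norm_le e K0) simp
      ultimately show "\<bar>Re (cinner x ((e o\<^sub>L u o\<^sub>L e) x))\<bar> \<le> K * (norm x)\<^sup>2" by simp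
    qed
    then have "s \<le> K" unfolding s_def using K0 by (intro norm_blinfun_bound)
    then have "s\<^sup>2 \<le> K\<^sup>2" by (intro power_mono) (simp_all add: s_def)
    then have "(1 - 2 * \<delta>\<^sup>2)\<^sup>2 \<le> 1 - s\<^sup>2" unfolding K2 by (simp add: power2_eq_square algebra_simps)
    then show ?thesis by (rule real_le_rsqrt)
  qed
  moreover have "0 \<le> sqrt (1 - s\<^sup>2)"
  proof -
    have "s \<le> 1" unfolding s_def by (rule norm_compression_le_1[OF e u])
    then show ?thesis by (simp add: s_def abs_square_le_1)
  qed
  ultimately have "1 / 2 * (1 - sqrt (1 - s\<^sup>2)) \<le> \<delta>\<^sup>2" by argo
  then show ?thesis unfolding s_def[symmetric] \<delta>_def[symmetric] using \<delta>0 by (intro real_le_lsqrt) auto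
qed

text \<open>After normalization of \<open>x\<close>, all generators lie in the algebra of
  \<open>wstar_algebra_eigenvector\<close>, hermiticity supplying its second condition; hence so
  does \<open>T\<close>.\<close>

lemma wstar_generated_eigenvector:
  assumes M: "M \<subseteq> bounded_ops" "\<And>T. T \<in> M \<Longrightarrow> hermitian T \<and> (\<exists>c. T x = c *\<^sub>C x)"
    and T: "T \<in> wstar_generated M"
  shows "\<exists>c. T x = c *\<^sub>C x"
proof (cases "x = 0")
  case True
  then show ?thesis by (simp add: scaleC_zero_right)
next
  case False
  define v where "v = (1 / norm x) *\<^sub>R x"
  have v: "norm v = 1" using False by (simp add: v_def)
  let ?A = "{T \<in> bounded_ops. \<forall>y. cinner y v = 0 \<longrightarrow> cinner y (T v) = 0 \<and> cinner v (T y) = 0}"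
  have "M \<subseteq> ?A"
  proof
    fix S assume S: "S \<in> M"
    then obtain c where c: "S x = c *\<^sub>C x" and h: "hermitian S" using M(2) by blast
    have Sv: "S v = c *\<^sub>C v"
      using M(1) S by (auto simp: v_def bounded_ops_def c scaleR_scaleC scaleC_scaleC mult.commute)
    have "cinner y (S v) = 0 \<and> cinner v (S y) = 0" if "cinner y v = 0" for y
    proof -
      have "cinner v y = 0" using that by (metis cinner_commute complex_cnj_zero)
      then show ?thesis
        using that hermitian_cinner[OF h, of v y] by (simp add: Sv cinner_scaleC_right cinner_scaleC_left)
    qed
    then show "S \<in> ?A" using M(1) S by blast
  qed
  then have "T \<in> ?A"
    using T wstar_algebra_eigenvector[OF v] by (auto simp: wstar_generated_def)
  then have Tv: "T v = cinner v (T v) *\<^sub>C v" by (intro unit_vector_scaleC_eqI v) blast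
  have xv: "x = norm x *\<^sub>R v" using False by (simp add: v_def)
  have "T x = norm x *\<^sub>R T v" by (subst xv) (simp only: blinfun.scaleR_right)
  also have "\<dots> = cinner v (T v) *\<^sub>C (norm x *\<^sub>R v)"
    by (subst Tv) (simp add: scaleR_scaleC scaleC_scaleC mult.commute)
  finally show ?thesis using xv by auto
qed

text \<open>\<open>x\<close> is an eigenvector of \<open>q\<close> as well, so 0 = q u q x = c q x =
  u q x. Thus \<open>q x = 0\<close>, and \<open>e - q\<close> fixes \<open>x\<close>.\<close>

lemma Q_set_norm_diff_ge_1:
  assumes e: "orthogonal_projection e" and u: "hermitian_involution u"
    and q: "q \<in> Q_set u" "q \<in> wstar_generated {e, u}"
    and x: "x \<noteq> 0" "e x = x" "u x = c *\<^sub>C x"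
  shows "1 \<le> norm (e - q)"
proof -
  have he: "hermitian e" and hu: "hermitian u" "\<And>x. u (u x) = x"
    using e u by (simp_all add: orthogonal_projection_iff hermitian_involution_iff)
  have uC: "u (b *\<^sub>C y) = b *\<^sub>C u y" for b y
    using hermitian_bounded_ops[OF hu(1)] by (simp add: bounded_ops_def)
  have "\<exists>b. q x = b *\<^sub>C x"
  proof (rule wstar_generated_eigenvector[OF _ _ q(2)])
    have "e x = 1 *\<^sub>C x" by (simp add: x scaleC_one)
    then show "hermitian T \<and> (\<exists>c. T x = c *\<^sub>C x)" if "T \<in> {e, u}" for T
      using that he hu x(3) by blast
  qed (simp add: he hu hermitian_bounded_ops)
  then obtain b where b: "q x = b *\<^sub>C x" by blast
  have hq: "hermitian q" "\<And>y. q (q y) = q y" "\<And>y. q (u (q y)) = 0"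
    using q(1) by (simp_all add: Q_set_iff orthogonal_projection_iff)
  have qC: "q (d *\<^sub>C y) = d *\<^sub>C q y" for d y
    using hermitian_bounded_ops[OF hq(1)] by (simp add: bounded_ops_def)
  have "c *\<^sub>C q x = 0"
  proof -
    have "0 = q (u (q x))" by (simp add: hq)
    also have "\<dots> = c *\<^sub>C q (b *\<^sub>C x)" by (simp add: b uC x(3) qC scaleC_scaleC mult_ac)
    also have "\<dots> = c *\<^sub>C q x" by (simp add: hq flip: b)
    finally show ?thesis by simp
  qed
  then have "q (u x) = 0" by (simp add: x(3) qC)
  have "u (q x) = 0" by (metis \<open>c *\<^sub>C q x = 0\<close> b uC x(3) scaleC_scaleC mult.commute)
  then have "q x = 0" by (metis hu(2) blinfun.zero_right)
  then have "norm x \<le> norm (e - q) * norm x"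
    using norm_blinfun[of "e - q" x] by (simp add: blinfun.diff_left x)
  then show ?thesis using x(1) by simp
qed

section \<open>Construction of a nearest projection\<close>

text \<open>\<open>lower\<close> bounds the angle from the range of \<open>e\<close> to that of
  \<open>q\<close>. By \<open>inj\<close> the same bound holds in the other direction, and
  \<open>e - q\<close> then splits into two orthogonal pieces controlled by 1 - c.\<close>

lemma norm_diff_projections_le:
  assumes e: "orthogonal_projection e" and q: "orthogonal_projection q"
    and c: "0 < c" "c \<le> 1"
    and lower: "\<And>x. e x = x \<Longrightarrow> c * (norm x)\<^sup>2 \<le> (norm (q x))\<^sup>2"
    and inj: "\<And>y. q y = y \<Longrightarrow> e y = 0 \<Longrightarrow> y = 0"
  shows "norm (e - q) \<le> sqrt (1 - c)"
proof -
  have he: "hermitian e" "\<And>x. e (e x) = e x" and hq: "hermitian q" "\<And>x. q (q x) = q x"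
    using e q by (simp_all add: orthogonal_projection_iff)
  define S where "S = q o\<^sub>L e o\<^sub>L q"
  have S: "S x = q (e (q x))" for x by (simp add: S_def)
  have hS: "hermitian S" unfolding S_def by (intro hermitian_sandwich hq he)
  obtain f where f: "orthogonal_projection f" "\<And>x. f (S x) = S x" "\<And>x. \<exists>w. (\<lambda>n. S (w n)) \<longlonglongrightarrow> f x"
    using hermitian_support_projection[OF hS] by metis
  have hf: "hermitian f" using f(1) by (simp add: orthogonal_projection_iff)
  \<comment> \<open>by \<open>inj\<close>, the image under \<open>q\<close> of the range of \<open>e\<close> is dense in the range of \<open>q\<close>\<close>
  have dense: "\<exists>w. (\<lambda>n. q (e (w n))) \<longlonglongrightarrow> y" if y: "q y = y" for y
  proof -
    \<comment> \<open>\<open>y - f y\<close> is orthogonal to the range of the hermitian operator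
      \<open>S\<close>.\<close>
    have "S (y - f y) = 0"
      by (rule cinner_left_eqI)
        (simp add: hermitian_cinner[OF hS] hermitian_cinner[OF hf] f(2) cinner_simps)
    then have qe: "q (e (q (y - f y))) = 0" by (simp add: S)
    define v where "v = q (y - f y)"
    have qv: "q v = v" by (simp add: v_def hq)
    have "cinner (e v) (e v) = cinner (q (e v)) v"
      by (simp add: hermitian_cinner[OF he(1)] he hermitian_cinner[OF hq(1)] qv)
    also have "\<dots> = 0" using qe by (simp add: v_def cinner_simps)
    finally have "v = 0" using inj qv by (simp add: cinner_eq_zero_iff)
    then have yf: "y = q (f y)" by (simp add: v_def blinfun.diff_right y)
    obtain w where "(\<lambda>n. S (w n)) \<longlonglongrightarrow> f y" using f(3) by blast
    then have "(\<lambda>n. q (S (w n))) \<longlonglongrightarrow> q (f y)"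
      by (rule bounded_linear.tendsto[OF blinfun.bounded_linear_right])
    then have "(\<lambda>n. q (e (q (w n)))) \<longlonglongrightarrow> y" using yf by (simp add: S hq)
    then show ?thesis by (rule exI[of _ "\<lambda>n. q (w n)"])
  qed
  have upper: "c * (norm y)\<^sup>2 \<le> (norm (e y))\<^sup>2" if y: "q y = y" for y
  proof -
    obtain w where w: "(\<lambda>n. q (e (w n))) \<longlonglongrightarrow> y" using dense[OF y] by blast
    \<comment> \<open>For v = q e x one has |v|^2 = Re <e x, e v>; squaring and inserting c |e x|^2
      \<le> |v|^2 gives the bound on a dense set.\<close>
    have "c * (norm v)\<^sup>2 \<le> (norm (e v))\<^sup>2" if v: "v = q (e x)" for v x
    proof (cases "v = 0")
      case False
      have "(norm v)\<^sup>2 = Re (cinner (e x) v)"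
        using hermitian_cinner[OF hq(1), of "e x" v] by (simp add: v hq flip: Re_cinner_self)
      also have "\<dots> = Re (cinner (e x) (e v))"
        using hermitian_cinner[OF he(1), of "e x" v] by (simp add: he)
      also have "\<dots> \<le> norm (e x) * norm (e v)" by (rule Re_cinner_le)
      finally have "((norm v)\<^sup>2)\<^sup>2 \<le> (norm (e x) * norm (e v))\<^sup>2" by (intro power_mono) auto
      then have "c * ((norm v)\<^sup>2)\<^sup>2 \<le> c * (norm (e x) * norm (e v))\<^sup>2" using c(1) by simp
      also have "\<dots> = (c * (norm (e x))\<^sup>2) * (norm (e v))\<^sup>2" by (simp add: power_mult_distrib)
      also have "\<dots> \<le> (norm v)\<^sup>2 * (norm (e v))\<^sup>2"
        unfolding v by (intro mult_right_mono lower) (simp_all add: he)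
      finally have "(norm v)\<^sup>2 * (c * (norm v)\<^sup>2) \<le> (norm v)\<^sup>2 * (norm (e v))\<^sup>2"
        by (simp add: power2_eq_square[of "(norm v)\<^sup>2"] algebra_simps)
      then show ?thesis using False by simp
    qed simp
    then show ?thesis
      by (intro LIMSEQ_le[of "\<lambda>n. c * (norm (q (e (w n))))\<^sup>2" _ "\<lambda>n. (norm (e (q (e (w n)))))\<^sup>2"]
          tendsto_intros blinfun.tendsto w) auto
  qed
  define k where "k = 1 - c"
  have k: "0 \<le> k" using c by (simp add: k_def)
  have e_perp: "(norm (x - q x))\<^sup>2 \<le> k * (norm x)\<^sup>2" if "e x = x" for x
    using lower[OF that] orthogonal_projection_norm_sqr[OF q, of x] by (simp add: k_def algebra_simps)
  have q_perp: "(norm (x - e x))\<^sup>2 \<le> k * (norm x)\<^sup>2" if "q x = x" for x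
    using upper[OF that] orthogonal_projection_norm_sqr[OF e, of x] by (simp add: k_def algebra_simps)
  \<comment> \<open>Dual form of \<open>e_perp\<close>: (id - q) e and its adjoint e (id - q) have
    the same bound.\<close>
  have perp_e: "(norm (e z))\<^sup>2 \<le> k * (norm z)\<^sup>2" if z: "q z = 0" for z
  proof (cases "e z = 0")
    case False
    define w where "w = e z"
    have ew: "e w = w" by (simp add: w_def he)
    have "(norm w)\<^sup>2 = Re (cinner w z)"
      using hermitian_cinner[OF he(1), of w z] ew by (simp add: w_def flip: Re_cinner_self)
    also have "cinner w z = cinner (w - q w) z"
      by (simp add: cinner_simps hermitian_cinner[OF hq(1)] z)
    also have "Re (cinner (w - q w) z) \<le> norm (w - q w) * norm z" by (rule Re_cinner_le)
    finally have "((norm w)\<^sup>2)\<^sup>2 \<le> (norm (w - q w) * norm z)\<^sup>2" by (intro power_mono) auto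
    also have "\<dots> \<le> (k * (norm w)\<^sup>2) * (norm z)\<^sup>2"
      unfolding power_mult_distrib by (intro mult_right_mono e_perp ew) simp
    finally have "(norm w)\<^sup>2 * (norm w)\<^sup>2 \<le> (norm w)\<^sup>2 * (k * (norm z)\<^sup>2)"
      by (simp add: power2_eq_square[of "(norm w)\<^sup>2"] algebra_simps)
    then show ?thesis
      unfolding w_def by (rule mult_left_le_imp_le) (use False in simp)
  qed (use k in simp)
  have "norm ((e - q) x) \<le> sqrt k * norm x" for x
  proof -
    define y z where "y = q x" and "z = x - q x"
    have x: "x = y + z" by (simp add: y_def z_def)
    have qy: "q y = y" and qz: "q z = 0" by (simp_all add: y_def z_def blinfun.diff_right hq)
    have "(e - q) x = e z - (y - e y)"
      by (simp add: blinfun.diff_left x blinfun.add_right qy qz)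
    moreover have "cinner (e z) (y - e y) = 0"
      by (simp add: hermitian_cinner[OF he(1)] blinfun.diff_right he cinner_simps)
    ultimately have "(norm ((e - q) x))\<^sup>2 = (norm (e z))\<^sup>2 + (norm (y - e y))\<^sup>2"
      by (simp add: norm_diff_sqr)
    also have "\<dots> \<le> k * (norm z)\<^sup>2 + k * (norm y)\<^sup>2"
      by (intro add_mono perp_e q_perp qy qz)
    also have "\<dots> = k * (norm x)\<^sup>2"
      using orthogonal_projection_norm_sqr[OF q, of x] by (simp add: y_def z_def algebra_simps)
    also have "\<dots> = (sqrt k * norm x)\<^sup>2" using k by (simp add: power_mult_distrib)
    finally show ?thesis by (rule power2_le_imp_le) (simp add: k)
  qed
  then show ?thesis unfolding k_def[symmetric] by (intro norm_blinfun_bound) (simp_all add: k)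
qed

lemma wstar_generated_projection_involution:
  assumes e: "orthogonal_projection e" and u: "hermitian_involution u"
  shows "wstar_algebra (wstar_generated {e, u})"
    and "e \<in> wstar_generated {e, u}"
    and "u \<in> wstar_generated {e, u}"
    and "id_blinfun \<in> wstar_generated {e, u}"
proof -
  show W: "wstar_algebra (wstar_generated {e, u})"
    using e u by (intro wstar_algebra_generated)
      (simp add: orthogonal_projection_def hermitian_involution_def)
  show "e \<in> wstar_generated {e, u}" and uW: "u \<in> wstar_generated {e, u}"
    by (auto simp: wstar_generated_def)
  show "id_blinfun \<in> wstar_generated {e, u}"
    using wstar_compose[OF W uW uW] u by (simp add: hermitian_involution_def)
qed

text \<open>For N = e + u e u - id the two-projection identity N^2 + D^2 = id shows that Y = N^2 is
  a positive contraction. With \<open>Z\<close> from \<open>hermitian_sqrt\<close>, M = id - Z is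
  the square root of id - Y = D^2.\<close>

lemma abs_diff_projections:
  assumes e: "orthogonal_projection e" and u: "hermitian_involution u"
  obtains M where "hermitian M" "M \<in> wstar_generated {e, u}"
    "\<And>x. M (e x) = e (M x)" "\<And>x. M (u x) = u (M x)"
    "\<And>x. M (M x) = (e - (u o\<^sub>L e o\<^sub>L u)) ((e - (u o\<^sub>L e o\<^sub>L u)) x)"
    "\<And>x. 0 \<le> Re (cinner x (M x))"
    "\<And>x. Re (cinner x (M x)) = 0 \<Longrightarrow> M x = 0"
    "\<And>x. e x = x \<Longrightarrow> sqrt (1 - (norm (e o\<^sub>L u o\<^sub>L e))\<^sup>2) * (norm x)\<^sup>2 \<le> Re (cinner x (M x))"
proof -
  have he: "hermitian e" "\<And>x. e (e x) = e x" using e by (simp_all add: orthogonal_projection_iff)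
  have hu: "hermitian u" "\<And>x. u (u x) = x" using u by (simp_all add: hermitian_involution_iff)
  define D where "D = e - (u o\<^sub>L e o\<^sub>L u)"
  define N where "N = e + (u o\<^sub>L e o\<^sub>L u) - id_blinfun"
  define Y where "Y = N o\<^sub>L N"
  have hD: "hermitian D" unfolding D_def by (intro hermitian_diff hermitian_sandwich he hu)
  have hN: "hermitian N" unfolding N_def by (intro hermitian_diff hermitian_add hermitian_sandwich he hu hermitian_id)
  have hY: "hermitian Y" unfolding Y_def by (rule hermitian_square[OF hN])
  note blin = blinfun.add_left blinfun.diff_left blinfun.add_right blinfun.diff_right
  have D: "D x = e x - u (e (u x))" for x by (simp add: D_def blin)
  have N: "N x = e x + u (e (u x)) - x" for x by (simp add: N_def blin)
  have Y: "Y x = x - D (D x)" for x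
    by (simp add: Y_def N D blin he hu)
  have Ye: "Y (e x) = e (Y x)" and Yu: "Y (u x) = u (Y x)" and Yee: "Y (e x) = e (u (e (u (e x))))" for x
    by (simp_all add: Y D blin he hu)
  have YN: "Re (cinner x (Y x)) = (norm (N x))\<^sup>2" for x
    by (simp add: Y_def Re_cinner_self flip: hermitian_cinner[OF hN, of x "N x"])
  have YD: "Re (cinner x (Y x)) = (norm x)\<^sup>2 - (norm (D x))\<^sup>2" for x
    by (simp add: Y cinner_simps Re_cinner_self flip: hermitian_cinner[OF hD, of x "D x"])
  have "norm Y \<le> 1"
  proof (rule norm_blinfun_bound)
    fix x
    have "\<bar>Re (cinner x (Y x))\<bar> \<le> 1 * (norm x)\<^sup>2" for x
      using YN[of x] YD[of x] zero_le_power2[of "norm (N x)"] zero_le_power2[of "norm (D x)"] by linarith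
    then show "norm (Y x) \<le> 1 * norm x" by (rule norm_hermitian_le[OF hY])
  qed simp
  then obtain Z where Z: "hermitian Z" "norm Z \<le> 1" "2 *\<^sub>R Z = Y + (Z o\<^sub>L Z)"
    "\<And>A. wstar_algebra A \<Longrightarrow> Y \<in> A \<Longrightarrow> Z \<in> A"
    using hermitian_sqrt[OF hY] by metis
  have ZZ: "Z (Z x) = 2 *\<^sub>R Z x - Y x" for x
    using arg_cong[OF Z(3), of "\<lambda>T. blinfun_apply T x"] by (simp add: blin blinfun.scaleR_left)
  \<comment> \<open>\<open>Y\<close> lies in both commutants, hence so does
    \<open>Z\<close>.\<close>
  have "Z \<in> {T \<in> bounded_ops. \<forall>x. T (e x) = e (T x)}" "Z \<in> {T \<in> bounded_ops. \<forall>x. T (u x) = u (T x)}"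
    by (rule Z(4), intro wstar_algebra_commutant he hu, simp add: hermitian_bounded_ops[OF hY] Ye Yu)+
  then have Ze: "Z (e x) = e (Z x)" and Zu: "Z (u x) = u (Z x)" for x by auto
  note W = wstar_generated_projection_involution(1)[OF e u]
    and eW = wstar_generated_projection_involution(2)[OF e u]
    and uW = wstar_generated_projection_involution(3)[OF e u]
    and idW = wstar_generated_projection_involution(4)[OF e u]
  have YW: "Y \<in> wstar_generated {e, u}"
    unfolding Y_def N_def by (intro wstar_compose wstar_diff wstar_add W eW uW idW)
  define M where "M = id_blinfun - Z"
  have M: "M x = x - Z x" for x by (simp add: M_def blin)
  have Zx: "norm (Z x) \<le> norm x" for x
    using norm_blinfun[of Z x] mult_right_mono[OF Z(2) norm_ge_zero[of x]] by simp
  have ReM: "Re (cinner x (M x)) = (norm x)\<^sup>2 - Re (cinner x (Z x))" for x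
    by (simp add: M cinner_simps Re_cinner_self)
  have le: "Re (cinner x (Z x)) \<le> norm x * norm (Z x)" for x by (rule Re_cinner_le)
  show ?thesis
  proof (rule that)
    show "hermitian M" unfolding M_def by (intro hermitian_diff hermitian_id Z)
    show "M \<in> wstar_generated {e, u}" unfolding M_def by (intro wstar_diff W idW Z(4) YW)
    show "M (e x) = e (M x)" "M (u x) = u (M x)" for x by (simp_all add: M blin Ze Zu)
    show "M (M x) = (e - (u o\<^sub>L e o\<^sub>L u)) ((e - (u o\<^sub>L e o\<^sub>L u)) x)" for x
      unfolding D_def[symmetric] by (simp add: M blin ZZ Y scaleR_2)
    show "0 \<le> Re (cinner x (M x))" for x
      using le[of x] mult_left_mono[OF Zx[of x] norm_ge_zero[of x]] by (simp add: ReM power2_eq_square)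
    \<comment> \<open>If the form of \<open>M\<close> vanishes at \<open>x\<close>, then |M x|^2 =
      |Z x|^2 - |x|^2, which is at most 0.\<close>
    show "M x = 0" if "Re (cinner x (M x)) = 0" for x
    proof -
      have "(norm (M x))\<^sup>2 = (norm x)\<^sup>2 - 2 * Re (cinner x (Z x)) + (norm (Z x))\<^sup>2"
        by (simp add: M norm_diff_sqr)
      also have "\<dots> = (norm (Z x))\<^sup>2 - (norm x)\<^sup>2" using that by (simp add: ReM)
      also have "\<dots> \<le> 0" using Zx[of x] by (simp add: power_mono)
      finally show ?thesis by simp
    qed
    \<comment> \<open>\<open>2 Z e = (e u e)\<^sup>2 + (Z e)\<^sup>2\<close> turns into a quadratic inequality for \<open>\<zeta> = \<parallel>Z e\<parallel> \<le> 1\<close>\<close>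
    define s where "s = norm (e o\<^sub>L u o\<^sub>L e)"
    define \<zeta> where "\<zeta> = norm (Z o\<^sub>L e)"
    have ex: "norm (e x) \<le> norm x" for x by (rule orthogonal_projection_norm_le[OF e])
    have "\<zeta> \<le> 1" unfolding \<zeta>_def
      by (rule norm_blinfun_bound) (use order_trans[OF Zx ex] in auto)
    have ux: "norm ((e o\<^sub>L u o\<^sub>L e) x) \<le> s * norm x" for x unfolding s_def by (rule norm_blinfun)
    have "norm ((2 *\<^sub>R (Z o\<^sub>L e)) x) \<le> (s\<^sup>2 + \<zeta>\<^sup>2) * norm x" for x
    proof -
      have "(2 *\<^sub>R (Z o\<^sub>L e)) x = (e o\<^sub>L u o\<^sub>L e) ((e o\<^sub>L u o\<^sub>L e) x) + (Z o\<^sub>L e) ((Z o\<^sub>L e) x)"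
        by (simp add: blinfun.scaleR_left Ze[symmetric] he ZZ Yee)
      moreover have "norm ((e o\<^sub>L u o\<^sub>L e) ((e o\<^sub>L u o\<^sub>L e) x)) \<le> s * (s * norm x)"
        by (intro order_trans[OF ux] mult_left_mono ux) (simp add: s_def)
      moreover have "norm ((Z o\<^sub>L e) ((Z o\<^sub>L e) x)) \<le> \<zeta> * (\<zeta> * norm x)"
        unfolding \<zeta>_def by (intro order_trans[OF norm_blinfun] mult_left_mono norm_blinfun norm_ge_zero)
      ultimately show ?thesis
        using norm_triangle_ineq[of "(e o\<^sub>L u o\<^sub>L e) ((e o\<^sub>L u o\<^sub>L e) x)" "(Z o\<^sub>L e) ((Z o\<^sub>L e) x)"]
        by (simp add: power2_eq_square algebra_simps)
    qed
    then have "norm (2 *\<^sub>R (Z o\<^sub>L e)) \<le> s\<^sup>2 + \<zeta>\<^sup>2" by (intro norm_blinfun_bound) auto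
    then have "2 * \<zeta> \<le> s\<^sup>2 + \<zeta>\<^sup>2" by (simp add: \<zeta>_def)
    then have "1 - s\<^sup>2 \<le> (1 - \<zeta>)\<^sup>2" by (simp add: power2_eq_square algebra_simps)
    then have s\<zeta>: "sqrt (1 - s\<^sup>2) \<le> 1 - \<zeta>" using \<open>\<zeta> \<le> 1\<close> by (intro real_le_lsqrt) auto
    show "sqrt (1 - (norm (e o\<^sub>L u o\<^sub>L e))\<^sup>2) * (norm x)\<^sup>2 \<le> Re (cinner x (M x))" if x: "e x = x" for x
    proof -
      have "norm (Z x) \<le> \<zeta> * norm x"
        using norm_blinfun[of "Z o\<^sub>L e" x] by (simp add: \<zeta>_def x)
      then have "norm x * norm (Z x) \<le> \<zeta> * (norm x)\<^sup>2"
        using mult_left_mono[of _ _ "norm x"] by (fastforce simp: power2_eq_square algebra_simps)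
      then have "(1 - \<zeta>) * (norm x)\<^sup>2 \<le> Re (cinner x (M x))"
        using le[of x] by (simp add: ReM algebra_simps)
      moreover have "sqrt (1 - s\<^sup>2) * (norm x)\<^sup>2 \<le> (1 - \<zeta>) * (norm x)\<^sup>2"
        using s\<zeta> by (intro mult_right_mono) auto
      ultimately show ?thesis unfolding s_def by linarith
    qed
  qed
qed

lemma exists_near_Q_set:
  assumes e: "orthogonal_projection e" and u: "hermitian_involution u"
    and generic: "\<And>x. e x = x \<Longrightarrow> u x = x \<or> u x = - x \<Longrightarrow> x = 0"
  shows "\<exists>q \<in> Q_set u \<inter> wstar_generated {e, u}.
    norm (e - q) \<le> sqrt (1 / 2 * (1 - sqrt (1 - (norm (e o\<^sub>L u o\<^sub>L e))\<^sup>2)))"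
proof -
  have he: "hermitian e" "\<And>x. e (e x) = e x" using e by (simp_all add: orthogonal_projection_iff)
  have hu: "hermitian u" "\<And>x. u (u x) = x" using u by (simp_all add: hermitian_involution_iff)
  define c where "c = sqrt (1 - (norm (e o\<^sub>L u o\<^sub>L e))\<^sup>2)"
  define D where "D = e - (u o\<^sub>L e o\<^sub>L u)"
  obtain M where M: "hermitian M" "M \<in> wstar_generated {e, u}"
    "\<And>x. M (e x) = e (M x)" "\<And>x. M (u x) = u (M x)" "\<And>x. M (M x) = D (D x)"
    "\<And>x. 0 \<le> Re (cinner x (M x))" "\<And>x. Re (cinner x (M x)) = 0 \<Longrightarrow> M x = 0"
    "\<And>x. e x = x \<Longrightarrow> c * (norm x)\<^sup>2 \<le> Re (cinner x (M x))"
    unfolding c_def D_def by (rule abs_diff_projections[OF e u]) blast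
  have hD: "hermitian D" unfolding D_def by (intro hermitian_diff hermitian_sandwich he hu)
  note blin = blinfun.add_left blinfun.diff_left blinfun.add_right blinfun.diff_right
    blinfun.minus_left blinfun.minus_right blinfun.scaleR_left blinfun.scaleR_right
  have D: "D x = e x - u (e (u x))" for x by (simp add: D_def blin)
  have MD: "M (D x) = D (M x)" for x by (simp add: D blin M(3,4))
  have Du: "D (u x) = - u (D x)" for x by (simp add: D blin hu)
  have D_zero: "D x = 0" if "M x = 0" for x
  proof -
    have "cinner (D x) (D x) = cinner x (M (M x))" by (simp add: hermitian_cinner[OF hD] M(5))
    then show ?thesis by (simp add: that cinner_simps cinner_eq_zero_iff)
  qed
  have inj_e: "x = 0" if "e x = x" "M x = 0" for x
  proof -
    have "x = u (e (u x))" using D_zero[OF that(2)] that(1) by (simp add: D)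
    then have "u x = e (u x)" by (metis hu(2))
    \<comment> \<open>Both vectors lie in the range of \<open>e\<close> and are eigenvectors of
      \<open>u\<close>, for 1 and -1.\<close>
    then have "x + u x = 0" "x - u x = 0"
      by (intro generic; simp add: blin that(1) hu)+
    then have "2 *\<^sub>R x = 0" unfolding scaleR_2 by (metis add_eq_0_iff eq_iff_diff_eq_0 neg_equal_iff_equal)
    then show ?thesis by simp
  qed
  define R where "R = M + D"
  have R: "R x = M x + D x" for x by (simp add: R_def blin)
  have hR: "hermitian R" unfolding R_def by (intro hermitian_add M hD)
  obtain q where q: "orthogonal_projection q"
    "\<And>A. wstar_algebra A \<Longrightarrow> id_blinfun \<in> A \<Longrightarrow> R \<in> A \<Longrightarrow> q \<in> A"
    "\<And>x. q (R x) = R x" "\<And>x. R x = 0 \<Longrightarrow> q x = 0"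
    using hermitian_support_projection[OF hR] by metis
  have hq: "hermitian q" "\<And>x. q (q x) = q x" using q(1) by (simp_all add: orthogonal_projection_iff)
  note W = wstar_generated_projection_involution(1)[OF e u]
    and eW = wstar_generated_projection_involution(2)[OF e u]
    and uW = wstar_generated_projection_involution(3)[OF e u]
    and idW = wstar_generated_projection_involution(4)[OF e u]
  have qW: "q \<in> wstar_generated {e, u}"
    by (rule q(2)[OF W idW]) (unfold R_def D_def, intro wstar_add wstar_diff wstar_compose W M(2) eW uW)
  \<comment> \<open>u R = (M - D) u, and (M + D) (M - D) = M^2 - D^2 = 0 because \<open>M\<close>
    and \<open>D\<close> commute.\<close>
  have "R (u (R x)) = 0" for x by (simp add: R blin Du M(4,5) MD)
  then have quR: "q (u (R x)) = 0" for x by (simp add: q(4))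
  have "R (u (q x)) = 0" for x
    by (rule cinner_left_eqI)
      (simp add: hermitian_cinner[OF hR] hermitian_cinner[OF hu(1)] hermitian_cinner[OF hq(1)] quR cinner_simps)
  then have "q \<in> Q_set u" using q(1) by (simp add: Q_set_iff q(4))
  have qM: "2 *\<^sub>R q (M x) = R x" for x
  proof -
    \<comment> \<open>Conjugation by \<open>u\<close> reverses the sign of \<open>D\<close>, so D
      cancels; applying \<open>q\<close> then removes the second term.\<close>
    have "2 *\<^sub>R M x = R x + u (R (u x))" by (simp add: R blin Du M(4) hu scaleR_2)
    then have "q (2 *\<^sub>R M x) = R x" by (simp add: blin q(3) quR)
    then show ?thesis by (simp add: blin)
  qed
  \<comment> \<open>\<open>X\<close> measures the failure of 2 e q e = e + e M e. It satisfies X M =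
    0 because e D e = D^2 e; hence M X = 0, and \<open>M\<close> is injective on the range of
    \<open>e\<close>.\<close>
  define X where "X = 2 *\<^sub>R (e o\<^sub>L q o\<^sub>L e) - e - (e o\<^sub>L M o\<^sub>L e)"
  have hX: "hermitian X" unfolding X_def by (intro hermitian_diff hermitian_scaleR hermitian_sandwich he hq M)
  have X: "X x = 2 *\<^sub>R e (q (e x)) - e x - e (M (e x))" for x by (simp add: X_def blin)
  have eDD: "e (D (D x)) = D (D (e x))" for x by (simp add: D blin he hu)
  have XM: "X (M x) = 0" for x
  proof -
    have "X (M x) = e (2 *\<^sub>R q (M (e x))) - M (e x) - M (M (e x))"
      by (simp add: X blin M(3) he)
    also have "\<dots> = e (D (e x)) - D (D (e x))" by (simp only: qM) (simp add: R blin M(3,5) he eDD)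
    also have "\<dots> = 0" by (simp add: D blin he hu)
    finally show ?thesis .
  qed
  have X0: "X x = 0" for x
  proof (rule inj_e)
    show "e (X x) = X x" by (simp add: X blin he)
    show "M (X x) = 0" by (rule hermitian_compose_zero_commute[OF hX M(1) XM])
  qed
  have c0: "0 \<le> c" "c \<le> 1"
    using norm_compression_le_1[OF e u] by (simp_all add: c_def abs_square_le_1)
  \<comment> \<open>The constant comes from 2 |q x|^2 = |x|^2 + Re <x, M x> \<ge> (1 + c) |x|^2 on
    the range of \<open>e\<close>.\<close>
  have "norm (e - q) \<le> sqrt (1 - (1 + c) / 2)"
  proof (rule norm_diff_projections_le[OF e q(1)])
    show "0 < (1 + c) / 2" "(1 + c) / 2 \<le> 1" using c0 by auto
    show "(1 + c) / 2 * (norm x)\<^sup>2 \<le> (norm (q x))\<^sup>2" if x: "e x = x" for x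
    proof -
      have "2 *\<^sub>R e (q x) = x + M x" using X0[of x] x M(3)[of x] by (simp add: X algebra_simps)
      then have "2 * Re (cinner x (e (q x))) = Re (cinner x (x + M x))"
        by (simp add: cinner_scaleR_right flip: \<open>2 *\<^sub>R e (q x) = x + M x\<close>)
      moreover have "cinner x (e (q x)) = cinner x (q x)"
        using hermitian_cinner[OF he(1), of x "q x"] x by simp
      moreover have "Re (cinner x (q x)) = (norm (q x))\<^sup>2"
        by (rule orthogonal_projection_cinner_self[OF q(1)])
      ultimately have "2 * (norm (q x))\<^sup>2 = (norm x)\<^sup>2 + Re (cinner x (M x))"
        by (simp add: cinner_simps Re_cinner_self)
      then show ?thesis using M(8)[OF x] by (simp add: field_simps)
    qed
    \<comment> \<open>On the range of \<open>q\<close> the forms of \<open>M\<close> and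
      \<open>D\<close> agree, while e y = 0 makes that of \<open>D\<close> equal to -|e u y|^2.
      Positivity of \<open>M\<close> then gives M y = D y = 0.\<close>
    show "y = 0" if y: "q y = y" "e y = 0" for y
    proof -
      have "R (D x - M x) = 0" for x by (simp add: R blin MD M(5))
      then have qD: "q (D x) = q (M x)" for x using q(4)[of "D x - M x"] by (simp add: blin)
      have "cinner y (D y) = cinner y (q (D y))"
        using hermitian_cinner[OF hq(1), of y "D y"] y(1) by simp
      also have "\<dots> = cinner y (M y)"
        using hermitian_cinner[OF hq(1), of y "M y"] y(1) by (simp add: qD)
      finally have "Re (cinner y (M y)) = Re (cinner y (D y))" by simp
      also have "cinner y (D y) = - cinner (e (u y)) (e (u y))"
        by (simp add: D y(2) cinner_simps hermitian_cinner[OF he(1)] he flip: hermitian_cinner[OF hu(1)])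
      finally have "Re (cinner y (M y)) \<le> 0" by (simp add: Re_cinner_self)
      then have "M y = 0" using M(6,7)[of y] by linarith
      then have "R y = 0" using D_zero by (simp add: R)
      then show "y = 0" using q(4) y(1) by metis
    qed
  qed
  also have "1 - (1 + c) / 2 = 1 / 2 * (1 - c)" by (simp add: field_simps)
  finally show ?thesis using \<open>q \<in> Q_set u\<close> qW unfolding c_def by blast
qed

section \<open>Evaluation of the infimum in the two cases\<close>

theorem theorem2:
  fixes e u :: "'a::complex_hilbert \<Rightarrow>\<^sub>L 'a" and d :: real
  assumes "orthogonal_projection e"
    and "hermitian_involution u"
    and "d = Inf {norm (e - q) | q. q \<in> Q_set u \<inter> wstar_generated {e, u}}"
  shows "if range e \<inter> eigenspace u 1 \<noteq> {0} \<or> range e \<inter> eigenspace u (-1) \<noteq> {0}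
    then d = 1
    else d = sqrt (1 / 2 * (1 - sqrt (1 - (norm (e o\<^sub>L u o\<^sub>L e))\<^sup>2)))"
proof -
  note W = wstar_generated_projection_involution(1)[OF assms(1,2)]
  define S where "S = {norm (e - q) | q. q \<in> Q_set u \<inter> wstar_generated {e, u}}"
  \<comment> \<open>The zero projection is admissible at distance |e| \<le> 1, which gives the upper
    bound when there is a common eigenvector.\<close>
  have "0 \<in> Q_set u \<inter> wstar_generated {e, u}"
    using wstar_zero[OF W] by (simp add: Q_set_iff orthogonal_projection_iff hermitian_zero)
  then have "norm e \<in> S" unfolding S_def using diff_0_right[of e] by (metis (mono_tags, lifting) mem_Collect_eq)
  have dI: "d = r" if "r' \<in> S" "r' \<le> r" "\<And>s. s \<in> S \<Longrightarrow> r \<le> s" for r r'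
  proof -
    have "Inf S = r" using that by (intro cInf_eq) (auto intro: order_trans)
    then show ?thesis using assms(3) by (simp add: S_def)
  qed
  have e_range: "x \<in> range e \<longleftrightarrow> e x = x" for x
    using assms(1) by (metis orthogonal_projection_iff rangeE rangeI)
  have zero: "0 \<in> range e \<inter> eigenspace u c" for c
    by (simp add: e_range eigenspace_def scaleC_zero_right)
  have minus: "(- 1) *\<^sub>C x = - x" for x :: 'a
    using scaleR_scaleC[of "-1" x] by simp
  show ?thesis
  proof (cases "range e \<inter> eigenspace u 1 \<noteq> {0} \<or> range e \<inter> eigenspace u (-1) \<noteq> {0}")
    case True
    then obtain x c where x: "x \<noteq> 0" "e x = x" "u x = c *\<^sub>C x"
      using zero[of 1] zero[of "-1"] unfolding e_range[symmetric] eigenspace_def by blast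
    have "norm e \<le> 1"
      by (rule norm_blinfun_bound) (simp_all add: orthogonal_projection_norm_le assms(1))
    then have "d = 1"
      by (rule dI[OF \<open>norm e \<in> S\<close>])
        (use Q_set_norm_diff_ge_1[OF assms(1,2) _ _ x] in \<open>auto simp: S_def\<close>)
    with True show ?thesis by simp
  next
    case False
    have "x = 0" if "e x = x" "u x = x \<or> u x = - x" for x
      using that False by (auto simp: e_range eigenspace_def minus scaleC_one)
    then obtain q where q: "q \<in> Q_set u \<inter> wstar_generated {e, u}"
      "norm (e - q) \<le> sqrt (1 / 2 * (1 - sqrt (1 - (norm (e o\<^sub>L u o\<^sub>L e))\<^sup>2)))"
      using exists_near_Q_set[OF assms(1,2)] by blast
    have "norm (e - q) \<in> S" using q(1) by (auto simp: S_def)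
    then have "d = sqrt (1 / 2 * (1 - sqrt (1 - (norm (e o\<^sub>L u o\<^sub>L e))\<^sup>2)))"
      by (rule dI[OF _ q(2)]) (use Q_set_norm_diff_ge[OF assms(1,2)] in \<open>auto simp: S_def\<close>)
    with False show ?thesis by simp
  qed
qed

end
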